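(* Let $K=(H\otimes|0\rangle\langle0|)\,U_{\mathrm{CNOT}}\,(\mathbb{I}\otimes\sigma_x)$ and let $\mathcal{E}_{\mathrm K}(\cdot)=M(\cdot)M^\dagger$ with $M=K_{AA'}\otimes K_{BB'}$, $K_{AA'}=K_{BB'}=K$ (the successful branch of the protocol of Kálmán et al.). For an arbitrary two-qubit pure state $|\psi\rangle=c_1|00\rangle+c_2|01\rangle+c_3|10\rangle+c_4|11\rangle$, $c_i\in\mathbb{C}$, $\sum_i|c_i|^2=1$, apply $\mathcal{E}_{\mathrm K}$ to each of two pairs of copies of $|\psi\rangle$ and then apply $\mathcal{E}_{\mathrm K}$ to the two resulting (renormalized) states. Then this two-stage protocol conclusively produces $\phi^+$ from four copies of $|\psi\rangle$ with success probability $$2\left|c_2^4c_3^4\right|+2\left|c_1^4c_4^4\right|-4\,\mathrm{Re}\left[c_1^2c_4^2(c_2^* )^2(c_3^* )^2\right],$$ and this is the largest success probability achievable by a universal conclusive ECP on four copies based on concatenated two-qubit operations. Moreover, a single application of $\mathcal{E}_{\mathrm K}$ to two copies of $|\psi_S\rangle=\alpha|00\rangle+\beta|11\rangle$ ($|\alpha|^2+|\beta|^2=1$) produces $\phi^+$ with the optimal success probability $2|\alpha\beta|^2$ for universal conclusive ECPs on two copies over the set of such states.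
   Context: $H$ is the Hadamard gate, $\sigma_x$ the Pauli $X$ matrix, $U_{\mathrm{CNOT}}$ the CNOT gate with the first qubit ($A$, respectively $B$) as control and the second ($A'$, respectively $B'$) as target. Two copies $|\psi\rangle_{AB}\otimes|\psi\rangle_{A'B'}$ are shared by Alice (qubits $A,A'$) and Bob (qubits $B,B'$). After each application, the qubits $A'B'$ are discarded and the output is the state of $AB$. The probability of success of one application is the trace of the output, and the overall success probability of the two-stage protocol is the square of the Stage 1 success probability times the Stage 2 success probability on the renormalized Stage 1 outputs. $\psi=|\psi\rangle\langle\psi|$ and $|\phi^+\rangle=(|00\rangle+|11\rangle)/\sqrt2$. Universal conclusive ECP (entanglement concentration protocol) over a set $\mathcal{S}$ for $n$ copies: a completely positive trace non-increasing LOCC map $\mathcal{E}_1$ (completed to a trace-preserving map by another such LOCC map) from $n$ copies to one two-qubit state, with $\langle\phi^+|\mathcal{E}_1(\rho^{\otimes n})|\phi^+\rangle=\operatorname{Tr}[\mathcal{E}_1(\rho^{\otimes n})]$ for all $\rho\in\mathcal{S}$; its success probability on $\rho$ is $\operatorname{Tr}[\mathcal{E}_1(\rho^{\otimes n})]$. "Based on concatenated two-qubit operations" (for four copies, $\mathcal{S}$ all pure two-qubit states) means: Stage 1 applies to each of two pairs of copies the same LOCC map $\mathcal{E}_S(\cdot)=\sum_iM_i(\cdot)M_i^\dagger$ producing on success a pure state with the fixed Schmidt basis $\{|00\rangle,|11\rangle\}$ with input-dependent coefficients, where $M_i=K_i\otimes K_i$ on $\mathcal{H}_{AA'}\otimes\mathcal{H}_{BB'}$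 and product inputs do not lead to success; such maps are those with $K_i=a(|00\rangle\langle01|+|00\rangle\langle10|)+b(|10\rangle\langle01|-|10\rangle\langle10|)$, $a,b$ non-zero complex numbers with $2(|a|^4+|b|^4)\le1$. Stage 2 applies to the two renormalized Stage 1 outputs a universal conclusive ECP for two copies over the set of states $\alpha|00\rangle+\beta|11\rangle$. The protocol succeeds iff all steps succeed. *)

theory Defs
  imports Complex_Main "Jordan_Normal_Form.Schur_Decomposition"
begin

section \<open>Matrices, states and copies\<close>

definition kron :: "complex mat \<Rightarrow> complex mat \<Rightarrow> complex mat" where
  "kron A B = mat (dim_row A * dim_row B) (dim_col A * dim_col B)
     (\<lambda>(i, j). A $$ (i div dim_row B, j div dim_col B) * B $$ (i mod dim_row B, j mod dim_col B))"

definition ketbra :: "nat \<Rightarrow> nat \<Rightarrow> nat \<Rightarrow> complex mat" where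
  "ketbra d i j = mat d d (\<lambda>(k, l). if k = i \<and> l = j then 1 else 0)"

definition mtrace :: "complex mat \<Rightarrow> complex" where
  "mtrace A = (\<Sum>i<dim_row A. A $$ (i, i))"

definition msum :: "nat \<Rightarrow> complex mat list \<Rightarrow> complex mat" where
  "msum d Ms = foldr (+) Ms (0\<^sub>m d d)"

definition proj :: "complex vec \<Rightarrow> complex mat" where
  "proj v = mat (dim_vec v) (dim_vec v) (\<lambda>(i, j). v $ i * cnj (v $ j))"

definition pure_states :: "complex mat set" where
  "pure_states = {proj v | v. v \<in> carrier_vec 4 \<and> v \<bullet>c v = 1}"

definition schmidt_states :: "complex mat set" where
  "schmidt_states = {proj (vec_of_list [\<alpha>, 0, 0, \<beta>]) | \<alpha> \<beta>. (cmod \<alpha>)\<^sup>2 + (cmod \<beta>)\<^sup>2 = 1}"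

definition product_vec :: "complex vec \<Rightarrow> bool" where
  "product_vec v \<longleftrightarrow> (\<exists>u \<in> carrier_vec 2. \<exists>w \<in> carrier_vec 2.
     v = vec 4 (\<lambda>i. u $ (i div 2) * w $ (i mod 2)))"

definition phi_plus :: "complex vec" where
  "phi_plus = vec_of_list [1 / complex_of_real (sqrt 2), 0, 0, 1 / complex_of_real (sqrt 2)]"

text \<open>
  Multipartite indices list all of Alice's qubits first, then all of Bob's, each in big-endian
  order: \<open>n\<close> copies live on \<open>A\<^sub>1 \<dots> A\<^sub>n B\<^sub>1 \<dots> B\<^sub>n\<close>, so that for \<open>n = 2\<close> the order is \<open>A A' B B'\<close>.
  \<open>pair_index n c k\<close> is the index in \<open>{0..<4}\<close> of the \<open>c\<close>-th copy (counted from 0) inside the joint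
  index \<open>k\<close>, and \<open>copies n \<rho>\<close> is the \<open>n\<close>-fold tensor power of \<open>\<rho>\<close> in this ordering.
\<close>

definition qbit :: "nat \<Rightarrow> nat \<Rightarrow> nat \<Rightarrow> nat" where
  "qbit n c k = (k div 2 ^ (n - 1 - c)) mod 2"

definition pair_index :: "nat \<Rightarrow> nat \<Rightarrow> nat \<Rightarrow> nat" where
  "pair_index n c k = 2 * qbit n c (k div 2 ^ n) + qbit n c (k mod 2 ^ n)"

definition copies :: "nat \<Rightarrow> complex mat \<Rightarrow> complex mat" where
  "copies n \<rho> = mat (4 ^ n) (4 ^ n)
     (\<lambda>(k, l). \<Prod>c<n. \<rho> $$ (pair_index n c k, pair_index n c l))"


section \<open>LOCC maps\<close>

text \<open>Alice's factor comes first in each pair; \<open>d\<close> is the total output dimension.\<close>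

definition local_map :: "nat \<Rightarrow> (complex mat \<times> complex mat) list \<Rightarrow> complex mat \<Rightarrow> complex mat" where
  "local_map d bs \<rho> = msum d (map (\<lambda>(A, B). kron A B * \<rho> * mat_adjoint (kron A B)) bs)"

definition measurement :: "nat \<Rightarrow> complex mat list \<Rightarrow> bool" where
  "measurement d Ks \<longleftrightarrow> (\<forall>K \<in> set Ks. dim_col K = d) \<and>
     msum d (map (\<lambda>K. mat_adjoint K * K) Ks) = 1\<^sub>m d"

text \<open>
  \<open>locc_protocol dA dB bs\<close>: \<open>bs\<close> lists the accumulated Kraus operators \<open>(A, B)\<close>, acting as
  \<open>A \<otimes> B\<close>, of all outcome histories of a finite-round LOCC protocol. In a step one party measures,
  with an arbitrary complete measurement and arbitrary output dimensions; since a single history is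
  extended at a time, the measurement may depend on all earlier outcomes of both parties.
  Forgetting outcomes is a coarse-graining and is postponed to \<open>locc_instrument\<close>.
\<close>

inductive locc_protocol :: "nat \<Rightarrow> nat \<Rightarrow> (complex mat \<times> complex mat) list \<Rightarrow> bool"
  for dA dB :: nat where
  start: "locc_protocol dA dB [(1\<^sub>m dA, 1\<^sub>m dB)]"
| alice: "locc_protocol dA dB (xs @ (A, B) # ys) \<Longrightarrow> measurement (dim_row A) Ks \<Longrightarrow>
    locc_protocol dA dB (xs @ map (\<lambda>K. (K * A, B)) Ks @ ys)"
| bob: "locc_protocol dA dB (xs @ (A, B) # ys) \<Longrightarrow> measurement (dim_row B) Ks \<Longrightarrow>
    locc_protocol dA dB (xs @ map (\<lambda>K. (A, K * B)) Ks @ ys)"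

text \<open>
  \<open>E1\<close> and \<open>E2\<close> collect complementary sets of outcome histories of one LOCC protocol. Both are
  therefore completely positive and trace non-increasing, and \<open>E1 + E2\<close> is trace preserving.
\<close>

definition locc_instrument ::
  "nat \<Rightarrow> nat \<Rightarrow> nat \<Rightarrow> nat \<Rightarrow> (complex mat \<Rightarrow> complex mat) \<Rightarrow> (complex mat \<Rightarrow> complex mat) \<Rightarrow> bool" where
  "locc_instrument dA dB dA' dB' E1 E2 \<longleftrightarrow>
     (\<exists>bs I. locc_protocol dA dB bs \<and>
        (\<forall>(A, B) \<in> set bs. dim_row A = dA' \<and> dim_row B = dB') \<and>
        (\<forall>\<rho> \<in> carrier_mat (dA * dB) (dA * dB).
           E1 \<rho> = local_map (dA' * dB') (nths bs I) \<rho> \<and>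
           E2 \<rho> = local_map (dA' * dB') (nths bs (- I)) \<rho>))"


section \<open>Universal conclusive entanglement concentration\<close>

text \<open>\<open>\<langle>\<phi>\<^sup>+| X |\<phi>\<^sup>+\<rangle> = Tr X\<close>; note that \<open>\<bullet>c\<close> conjugates its second argument.\<close>

definition conclusive :: "complex mat \<Rightarrow> bool" where
  "conclusive X \<longleftrightarrow> (X *\<^sub>v phi_plus) \<bullet>c phi_plus = mtrace X"

definition universal_conclusive_ECP ::
  "nat \<Rightarrow> complex mat set \<Rightarrow> (complex mat \<Rightarrow> complex mat) \<Rightarrow> bool" where
  "universal_conclusive_ECP n S E \<longleftrightarrow>
     (\<exists>E'. locc_instrument (2 ^ n) (2 ^ n) 2 2 E E') \<and>
     (\<forall>\<rho> \<in> S. conclusive (E (copies n \<rho>)))"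

definition success_prob :: "nat \<Rightarrow> (complex mat \<Rightarrow> complex mat) \<Rightarrow> complex mat \<Rightarrow> real" where
  "success_prob n E \<rho> = Re (mtrace (E (copies n \<rho>)))"


section \<open>Concatenated two-qubit operations\<close>

text \<open>\<open>drop_second x\<close> is \<open>I \<otimes> \<langle>x|\<close>, so \<open>discard\<close> is the partial trace over \<open>A' B'\<close>.\<close>

definition drop_second :: "nat \<Rightarrow> complex mat" where
  "drop_second x = mat 2 4 (\<lambda>(i, j). if j = 2 * i + x then 1 else 0)"

definition discard_ops :: "(complex mat \<times> complex mat) list" where
  "discard_ops = [(drop_second x, drop_second y). x \<leftarrow> [0, 1], y \<leftarrow> [0, 1]]"

definition discard :: "complex mat \<Rightarrow> complex mat" where
  "discard = local_map 4 discard_ops"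

definition sym_ops :: "complex mat list \<Rightarrow> (complex mat \<times> complex mat) list" where
  "sym_ops Ks = [(K, K). K \<leftarrow> Ks]"

text \<open>The same product operators applied independently to two pairs of copies.\<close>

definition parallel :: "(complex mat \<times> complex mat) list \<Rightarrow> (complex mat \<times> complex mat) list" where
  "parallel bs = [(kron A C, kron B D). (A, B) \<leftarrow> bs, (C, D) \<leftarrow> bs]"

definition renorm :: "complex mat \<Rightarrow> complex mat" where
  "renorm X = (1 / mtrace X) \<cdot>\<^sub>m X"

definition stage1_out :: "complex mat list \<Rightarrow> complex mat \<Rightarrow> complex mat" where
  "stage1_out Ks \<rho> = discard (local_map 16 (sym_ops Ks) \<rho>)"

text \<open>In dimension 4 the basis index of \<open>|a a'\<rangle>\<close> is \<open>2 a + a'\<close>.\<close>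

definition stage1_kraus :: "complex \<Rightarrow> complex \<Rightarrow> complex mat" where
  "stage1_kraus a b = a \<cdot>\<^sub>m (ketbra 4 0 1 + ketbra 4 0 2) + b \<cdot>\<^sub>m (ketbra 4 2 1 - ketbra 4 2 2)"

definition stage1_family :: "complex mat list \<Rightarrow> bool" where
  "stage1_family Ks \<longleftrightarrow>
     (\<forall>K \<in> set Ks. \<exists>a b. a \<noteq> 0 \<and> b \<noteq> 0 \<and> 2 * (cmod a ^ 4 + cmod b ^ 4) \<le> 1 \<and> K = stage1_kraus a b) \<and>
     (\<exists>E'. locc_instrument 4 4 4 4 (local_map 16 (sym_ops Ks)) E') \<and>
     (\<forall>\<rho> \<in> pure_states. \<exists>\<alpha> \<beta>. stage1_out Ks (copies 2 \<rho>) = proj (vec_of_list [\<alpha>, 0, 0, \<beta>]))"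

text \<open>
  The two stages as one map on four copies, ordered \<open>A\<^sub>1 A\<^sub>1' A\<^sub>2 A\<^sub>2' B\<^sub>1 B\<^sub>1' B\<^sub>2 B\<^sub>2'\<close>; renormalization
  enters only through \<open>two_stage_prob\<close>, where a vanishing Stage 1 output counts as failure.
\<close>

definition concat_map ::
  "complex mat list \<Rightarrow> (complex mat \<Rightarrow> complex mat) \<Rightarrow> complex mat \<Rightarrow> complex mat" where
  "concat_map Ks E \<rho> =
     E (local_map 16 (parallel discard_ops) (local_map 256 (parallel (sym_ops Ks)) \<rho>))"

definition two_stage_prob ::
  "(complex mat \<Rightarrow> complex mat) \<Rightarrow> (complex mat \<Rightarrow> complex mat) \<Rightarrow> complex mat \<Rightarrow> real" where
  "two_stage_prob S E \<rho> =
     (success_prob 2 S \<rho>)\<^sup>2 * success_prob 2 E (renorm (S (copies 2 \<rho>)))"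

definition concatenated_ECP :: "complex mat list \<Rightarrow> (complex mat \<Rightarrow> complex mat) \<Rightarrow> bool" where
  "concatenated_ECP Ks E \<longleftrightarrow>
     stage1_family Ks \<and>
     universal_conclusive_ECP 2 schmidt_states E \<and>
     universal_conclusive_ECP 4 pure_states (concat_map Ks E) \<and>
     (\<forall>v \<in> carrier_vec 4. v \<bullet>c v = 1 \<longrightarrow> product_vec v \<longrightarrow>
        success_prob 4 (concat_map Ks E) (proj v) = 0)"


section \<open>The protocol of Kalman et al.\<close>

definition hadamard :: "complex mat" where
  "hadamard = (1 / complex_of_real (sqrt 2)) \<cdot>\<^sub>m mat_of_rows_list 2 [[1, 1], [1, - 1]]"

definition pauli_x :: "complex mat" where
  "pauli_x = mat_of_rows_list 2 [[0, 1], [1, 0]]"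

definition cnot :: "complex mat" where
  "cnot = mat_of_rows_list 4 [[1, 0, 0, 0], [0, 1, 0, 0], [0, 0, 0, 1], [0, 0, 1, 0]]"

definition kalman_K :: "complex mat" where
  "kalman_K = kron hadamard (ketbra 2 0 0) * cnot * kron (1\<^sub>m 2) pauli_x"

definition kalman_map :: "complex mat \<Rightarrow> complex mat" where
  "kalman_map \<rho> = kron kalman_K kalman_K * \<rho> * mat_adjoint (kron kalman_K kalman_K)"

definition kalman_out :: "complex mat \<Rightarrow> complex mat" where
  "kalman_out \<rho> = discard (kalman_map \<rho>)"

end

(* Writing a pure state as its coefficient matrix V, a product operator A (x) B acts by V -> A V B^T and
   copies are Kronecker powers of V. A stage 1 operator with coefficients a, b turns two copies of psi into
   diag (2 a^2 (p + q), 2 b^2 (p - q)), where p = c1 c4 and q = c2 c3. Completeness of the LOCC protocol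
   gives 4 * sum |a|^4 <= 1 and 4 * sum |b|^4 <= 1, with equality for the Kalman operator. In stage 2 a
   conclusive branch must kill the product components |00> and |11>, so it only sees the component
   alpha beta (|01>|01> + |10>|10>), whose squared norm is 2 |alpha beta|^2; the Kalman operator attains
   this too. Together this gives 2 |p^2 - q^2|^2, which is the stated formula. *)
theory Submission
  imports Defs "HOL-Library.Sublist"
begin

section \<open>Kronecker products, sums of operators and coefficient matrices\<close>

text \<open>A complete LOCC protocol preserves the squared Frobenius norm of every coefficient
  matrix, and dropping failed histories can only lower it. The upper bounds therefore test a map on
  well chosen unnormalized matrices that need not be copies of any state. For stage 1 these are
  |01>|01> + |10>|10> plus or minus |01>|10> + |10>|01>, both of squared norm 4: with one sign the
  row of \<open>a\<close> in each operator adds up to the output entry 4 a^2, with the other sign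
  the row of \<open>b\<close> to 4 b^2, whence the constant in 16 sum |a|^4 <= 4. The stage 2 bound
  depends on the stage 1 coefficients only through their product, so an operator that saturates the
  two constraints together is optimal for all psi at once. Renormalization does no harm because the
  stage 2 value has degree four in the amplitudes and thus scales inversely to the squared stage 1
  probability. For attainability the whole protocol has to be one LOCC instrument; its parties
  measure independently of each other's outcomes, and maps of this kind are closed under composition
  and parallel use.\<close>

lemma adjoint_carrier [simp, intro]: "A \<in> carrier_mat m n \<Longrightarrow> mat_adjoint A \<in> carrier_mat n m"
  by (rule carrier_matI) (auto simp: mat_adjoint_def)

lemma adjoint_dims [simp]:
  "dim_row (mat_adjoint A) = dim_col A" "dim_col (mat_adjoint A) = dim_row A"
  by (simp_all add: mat_adjoint_def)

lemma adjoint_index [simp]: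
  "i < dim_col A \<Longrightarrow> j < dim_row A \<Longrightarrow> mat_adjoint A $$ (i, j) = cnj (A $$ (j, i))"
  for A :: "complex mat"
  by (simp add: mat_adjoint_def mat_of_rows_def)

lemma mult_index: "i < dim_row A \<Longrightarrow> j < dim_col B \<Longrightarrow> dim_col A = dim_row B \<Longrightarrow>
    (A * B) $$ (i, j) = (\<Sum>k<dim_row B. A $$ (i, k) * B $$ (k, j))"
  by (simp add: scalar_prod_def atLeast0LessThan)

lemma mult_mat_vec_index: "i < dim_row A \<Longrightarrow> dim_col A = dim_vec v \<Longrightarrow>
    (A *\<^sub>v v) $ i = (\<Sum>k<dim_vec v. A $$ (i, k) * v $ k)"
  by (simp add: scalar_prod_def atLeast0LessThan)

lemma mat_mult_assoc:
  fixes A B C :: "'a::semiring_0 mat"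
  assumes "dim_col A = dim_row B" "dim_col B = dim_row C"
  shows "A * B * C = A * (B * C)"
  by (rule assoc_mult_mat[of A "dim_row A" "dim_row B" B "dim_row C" C "dim_col C"]) (use assms in auto)

lemma adjoint_mult:
  assumes "dim_col A = dim_row B"
  shows "mat_adjoint (A * B) = mat_adjoint B * mat_adjoint (A :: complex mat)"
  by (rule eq_matI) (use assms in \<open>simp_all add: mult_index mult.commute del: index_mult_mat(1)\<close>)

text \<open>Cuts \<open>{..<m * n}\<close> into \<open>m\<close> blocks of length \<open>n\<close>;
  every sum over a tensor product index becomes a double sum through it.\<close>

lemma sum_div_mod:
  fixes f :: "nat \<Rightarrow> nat \<Rightarrow> 'a::comm_monoid_add"
  shows "(\<Sum>k<m * n. f (k div n) (k mod n)) = (\<Sum>i<m. \<Sum>j<n. f i j)"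
proof -
  have "(\<Sum>i<m. \<Sum>j<n. f i j) = (\<Sum>i<m. \<Sum>k\<in>{i*n..<i*n+n}. f (k div n) (k mod n))"
  proof (rule sum.cong[OF refl])
    fix i
    have "(\<Sum>k\<in>{i*n..<i*n+n}. f (k div n) (k mod n)) = (\<Sum>k\<in>{0..<n}. f ((k + i*n) div n) ((k + i*n) mod n))"
      using sum.shift_bounds_nat_ivl[of "\<lambda>k. f (k div n) (k mod n)" 0 "i*n" n] by (simp add: add.commute)
    also have "\<dots> = (\<Sum>j<n. f i j)"
      by (rule sum.cong) auto
    finally show "(\<Sum>j<n. f i j) = (\<Sum>k\<in>{i*n..<i*n+n}. f (k div n) (k mod n))" by simp
  qed
  then show ?thesis
    by (simp add: sum.nat_group)
qed

lemma div_mod_less: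
  fixes i m n :: nat
  assumes "i < m * n"
  shows "i div n < m" "i mod n < n"
proof -
  have "n > 0" using assms by (cases n) auto
  then show "i div n < m" "i mod n < n"
    using assms by (simp_all add: less_mult_imp_div_less)
qed

lemma kron_dims [simp]:
  "dim_row (kron A B) = dim_row A * dim_row B" "dim_col (kron A B) = dim_col A * dim_col B"
  by (simp_all add: kron_def)

lemma kron_carrier [intro]:
  "A \<in> carrier_mat m n \<Longrightarrow> B \<in> carrier_mat m' n' \<Longrightarrow> kron A B \<in> carrier_mat (m * m') (n * n')"
  by (rule carrier_matI) auto

lemma kron_index:
  "i < dim_row A * dim_row B \<Longrightarrow> j < dim_col A * dim_col B \<Longrightarrow>
   kron A B $$ (i, j) = A $$ (i div dim_row B, j div dim_col B) * B $$ (i mod dim_row B, j mod dim_col B)"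
  by (simp add: kron_def)

lemma kron_mult:
  assumes "dim_col A = dim_row C" "dim_col B = dim_row D"
  shows "kron A B * kron C D = kron (A * C) (B * D)"
proof (rule eq_matI)
  fix i j assume "i < dim_row (kron (A * C) (B * D))" "j < dim_col (kron (A * C) (B * D))"
  then have i: "i < dim_row A * dim_row B" and j: "j < dim_col C * dim_col D" by auto
  note d = div_mod_less[OF i] div_mod_less[OF j]
  have "(kron A B * kron C D) $$ (i, j) =
      (\<Sum>p<dim_row C. \<Sum>q<dim_row D. A $$ (i div dim_row B, p) * B $$ (i mod dim_row B, q) *
         (C $$ (p, j div dim_col D) * D $$ (q, j mod dim_col D)))"
    unfolding sum_div_mod[symmetric]
    using i j assms by (simp add: mult_index kron_index del: index_mult_mat(1))
  also have "\<dots> = (A * C) $$ (i div dim_row B, j div dim_col D) * (B * D) $$ (i mod dim_row B, j mod dim_col D)"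
    using d assms
    by (simp add: mult_index sum_product mult_ac del: index_mult_mat(1))
  finally show "(kron A B * kron C D) $$ (i, j) = kron (A * C) (B * D) $$ (i, j)"
    using i j by (simp add: kron_index)
qed (use assms in auto)

lemma kron_adjoint: "mat_adjoint (kron A B) = kron (mat_adjoint A) (mat_adjoint B)"
  by (rule eq_matI) (auto simp: kron_index div_mod_less)

lemma kron_one: "kron (1\<^sub>m m) (1\<^sub>m n) = 1\<^sub>m (m * n)"
  by (rule eq_matI) (auto simp: kron_index div_mod_less, metis div_mult_mod_eq)

lemma kron_add_left:
  "A \<in> carrier_mat m n \<Longrightarrow> A' \<in> carrier_mat m n \<Longrightarrow> kron (A + A') B = kron A B + kron A' B"
  by (rule eq_matI) (auto simp: kron_index div_mod_less distrib_right)

lemma kron_add_right: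
  "B \<in> carrier_mat m n \<Longrightarrow> B' \<in> carrier_mat m n \<Longrightarrow> kron A (B + B') = kron A B + kron A B'"
  by (rule eq_matI) (auto simp: kron_index div_mod_less distrib_left)

lemma kron_zero_left: "kron (0\<^sub>m m n) B = 0\<^sub>m (m * dim_row B) (n * dim_col B)"
  by (rule eq_matI) (auto simp: kron_index div_mod_less)

lemma kron_zero_right: "kron A (0\<^sub>m m n) = 0\<^sub>m (dim_row A * m) (dim_col A * n)"
  by (rule eq_matI) (auto simp: kron_index div_mod_less)

section \<open>Sums of lists of square matrices\<close>

lemma msum_Nil [simp]: "msum d [] = 0\<^sub>m d d"
  and msum_Cons [simp]: "msum d (M # Ms) = M + msum d Ms"
  by (simp_all add: msum_def)

lemma msum_carrier [simp, intro]: "msum d Ms \<in> carrier_mat d d"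
  by (induction Ms) auto

lemma msum_dims [simp]: "dim_row (msum d Ms) = d" "dim_col (msum d Ms) = d"
  using carrier_matD[OF msum_carrier[of d Ms]] by auto

lemma msum_index: "i < d \<Longrightarrow> j < d \<Longrightarrow> msum d Ms $$ (i, j) = (\<Sum>M\<leftarrow>Ms. M $$ (i, j))"
  by (induction Ms) auto

lemma msum_append: "set Ms \<subseteq> carrier_mat d d \<Longrightarrow> msum d (Ms @ Ns) = msum d Ms + msum d Ns"
  by (induction Ms) (auto simp: assoc_add_mat[of _ d d])

lemma msum_concat:
  "(\<And>Ms. Ms \<in> set Mss \<Longrightarrow> set Ms \<subseteq> carrier_mat d d) \<Longrightarrow>
   msum d (concat Mss) = msum d (map (msum d) Mss)"
  by (induction Mss) (simp_all add: msum_append)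

lemma msum_sandwich:
  assumes "C \<in> carrier_mat m n" "D \<in> carrier_mat n m" "set Ms \<subseteq> carrier_mat n n"
  shows "C * msum n Ms * D = msum m (map (\<lambda>M. C * M * D) Ms)"
  using assms(3)
proof (induction Ms)
  case Nil
  then show ?case using assms by simp
next
  case (Cons M Ms)
  then have "C * (M + msum n Ms) * D = (C * M + C * msum n Ms) * D"
    using assms by (subst mult_add_distrib_mat[of C m n]) auto
  also have "\<dots> = C * M * D + C * msum n Ms * D"
    using assms Cons.prems by (subst add_mult_distrib_mat[of _ m n]) auto
  finally show ?case using Cons by simp
qed

lemma msum_kron_left:
  "set Ms \<subseteq> carrier_mat m m \<Longrightarrow> B \<in> carrier_mat n n \<Longrightarrow>
   kron (msum m Ms) B = msum (m * n) (map (\<lambda>M. kron M B) Ms)"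
  by (induction Ms) (simp_all add: kron_zero_left kron_add_left[of _ m m])

lemma msum_kron_right:
  "set Ms \<subseteq> carrier_mat m m \<Longrightarrow> A \<in> carrier_mat n n \<Longrightarrow>
   kron A (msum m Ms) = msum (n * m) (map (kron A) Ms)"
  by (induction Ms) (simp_all add: kron_zero_right kron_add_right[of _ m m])

lemma mtrace_msum:
  "set Ms \<subseteq> carrier_mat d d \<Longrightarrow> mtrace (msum d Ms) = (\<Sum>M\<leftarrow>Ms. mtrace M)"
  by (induction Ms) (auto simp: mtrace_def sum.distrib)

text \<open>A pure state of \<open>A \<otimes> B\<close> is represented by its coefficient matrix, with rows indexed by Alice
  and columns by Bob. Product operators then act by two-sided multiplication.\<close>

definition vecm :: "complex mat \<Rightarrow> complex vec" where
  "vecm V = vec (dim_row V * dim_col V) (\<lambda>k. V $$ (k div dim_col V, k mod dim_col V))"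

text \<open>The squared Frobenius norm, without a root: for the coefficient matrix of an
  unnormalized branch it is the probability of that branch.\<close>

definition fro :: "complex mat \<Rightarrow> real" where
  "fro V = (\<Sum>i<dim_row V. \<Sum>j<dim_col V. (cmod (V $$ (i, j)))\<^sup>2)"

text \<open>The unnormalized output vectors, one for each input and each Kraus pair. Bob's operator
  acts on the column index without conjugation, hence a transpose and not an adjoint.\<close>

definition act :: "(complex mat \<times> complex mat) list \<Rightarrow> complex mat list \<Rightarrow> complex mat list" where
  "act bs Vs = [A * V * B\<^sup>T. V \<leftarrow> Vs, (A, B) \<leftarrow> bs]"

text \<open>A mixture whose weights are carried by the norms of the coefficient matrices. The
  dimension is a parameter because an empty list does not determine it.\<close>

definition ensemble :: "nat \<Rightarrow> complex mat list \<Rightarrow> complex mat" where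
  "ensemble d Vs = msum d (map (\<lambda>V. proj (vecm V)) Vs)"

lemma vecm_dim [simp]: "dim_vec (vecm V) = dim_row V * dim_col V"
  by (simp add: vecm_def)

lemma proj_dims [simp]: "dim_row (proj v) = dim_vec v" "dim_col (proj v) = dim_vec v"
  by (simp_all add: proj_def)

lemma proj_index: "i < dim_vec v \<Longrightarrow> j < dim_vec v \<Longrightarrow> proj v $$ (i, j) = v $ i * cnj (v $ j)"
  by (simp add: proj_def)

lemma vecm_index: "k < dim_row V * dim_col V \<Longrightarrow> vecm V $ k = V $$ (k div dim_col V, k mod dim_col V)"
  by (simp add: vecm_def)

lemma fro_nonneg [simp]: "0 \<le> fro V"
  by (simp add: fro_def sum_nonneg)

lemma fro_transpose [simp]: "fro (V\<^sup>T) = fro V"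
  by (simp add: fro_def) (rule sum.swap)

lemma trace_proj_vecm: "mtrace (proj (vecm V)) = of_real (fro V)"
proof -
  have "mtrace (proj (vecm V)) =
      (\<Sum>i<dim_row V. \<Sum>j<dim_col V. of_real ((cmod (V $$ (i, j)))\<^sup>2))"
    unfolding sum_div_mod[symmetric]
    by (auto intro!: sum.cong simp: mtrace_def proj_index vecm_index complex_norm_square[symmetric] simp del: of_real_power)
  also have "\<dots> = of_real (fro V)"
    unfolding fro_def by simp
  finally show ?thesis .
qed

lemma fro_eq_mtrace: "of_real (fro V) = mtrace (mat_adjoint V * V)"
proof -
  have "mtrace (mat_adjoint V * V) = (\<Sum>j<dim_col V. \<Sum>i<dim_row V. of_real ((cmod (V $$ (i, j)))\<^sup>2))"
    by (simp add: mtrace_def mult_index complex_norm_square mult.commute del: index_mult_mat(1) of_real_power)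
  also have "\<dots> = of_real (fro V)"
    unfolding fro_def by (subst sum.swap) simp
  finally show ?thesis by simp
qed

lemma mult_proj:
  assumes "dim_col M = dim_vec v"
  shows "M * proj v * mat_adjoint M = proj (M *\<^sub>v v)"
proof (rule eq_matI)
  fix i j assume "i < dim_row (proj (M *\<^sub>v v))" "j < dim_col (proj (M *\<^sub>v v))"
  then have ij: "i < dim_row M" "j < dim_row M" by auto
  have "(M * proj v * mat_adjoint M) $$ (i, j) =
      (\<Sum>l<dim_vec v. (\<Sum>k<dim_vec v. M $$ (i, k) * v $ k) * cnj (M $$ (j, l) * v $ l))"
    using ij assms by (simp add: mult_index proj_index sum_distrib_left sum_distrib_right mult_ac del: index_mult_mat(1))
  also have "\<dots> = (\<Sum>k<dim_vec v. M $$ (i, k) * v $ k) * cnj (\<Sum>l<dim_vec v. M $$ (j, l) * v $ l)"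
    by (simp add: sum_distrib_left)
  also have "\<dots> = proj (M *\<^sub>v v) $$ (i, j)"
    using ij assms by (simp add: proj_index mult_mat_vec_index del: index_mult_mat_vec)
  finally show "(M * proj v * mat_adjoint M) $$ (i, j) = proj (M *\<^sub>v v) $$ (i, j)" .
qed (use assms in auto)

lemma sandwich_index:
  assumes "dim_col A = dim_row V" "dim_col B = dim_col V" "i < dim_row A" "j < dim_row B"
  shows "(A * V * B\<^sup>T) $$ (i, j) = (\<Sum>k<dim_row V. \<Sum>l<dim_col V. A $$ (i, k) * V $$ (k, l) * B $$ (j, l))"
proof -
  have "(A * V * B\<^sup>T) $$ (i, j) = (\<Sum>l<dim_col V. \<Sum>k<dim_row V. A $$ (i, k) * V $$ (k, l) * B $$ (j, l))"
    using assms by (simp add: mult_index sum_distrib_right del: index_mult_mat(1))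
  then show ?thesis by (simp only: sum.swap[of _ "{..<dim_row V}"])
qed

lemma kron_mult_vecm:
  assumes "dim_col A = dim_row V" "dim_col B = dim_col V"
  shows "kron A B *\<^sub>v vecm V = vecm (A * V * B\<^sup>T)"
proof (rule eq_vecI)
  fix i assume "i < dim_vec (vecm (A * V * B\<^sup>T))"
  then have i: "i < dim_row A * dim_row B" by simp
  have "(kron A B *\<^sub>v vecm V) $ i = (\<Sum>p<dim_row V. \<Sum>q<dim_col V.
      A $$ (i div dim_row B, p) * V $$ (p, q) * B $$ (i mod dim_row B, q))"
    unfolding sum_div_mod[symmetric]
    using i assms by (simp add: mult_mat_vec_index kron_index vecm_index mult_ac del: index_mult_mat_vec)
  also have "\<dots> = (A * V * B\<^sup>T) $$ (i div dim_row B, i mod dim_row B)"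
    using i assms by (subst sandwich_index) (auto simp: div_mod_less)
  finally show "(kron A B *\<^sub>v vecm V) $ i = vecm (A * V * B\<^sup>T) $ i"
    using i by (simp add: vecm_index)
qed auto

lemma kron_mult_proj_vecm:
  assumes "dim_col A = dim_row V" "dim_col B = dim_col V"
  shows "kron A B * proj (vecm V) * mat_adjoint (kron A B) = proj (vecm (A * V * B\<^sup>T))"
  using assms by (simp add: mult_proj kron_mult_vecm)

lemma ensemble_carrier [simp, intro]: "ensemble d Vs \<in> carrier_mat d d"
  by (simp add: ensemble_def)

lemma ensemble_dims [simp]: "dim_row (ensemble d Vs) = d" "dim_col (ensemble d Vs) = d"
  by (simp_all add: ensemble_def)

lemma ensemble_index: "i < d \<Longrightarrow> j < d \<Longrightarrow>
    ensemble d Vs $$ (i, j) = (\<Sum>V\<leftarrow>Vs. proj (vecm V) $$ (i, j))"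
  by (simp add: ensemble_def msum_index comp_def)

lemma proj_vecm_carrier: "V \<in> carrier_mat m n \<Longrightarrow> proj (vecm V) \<in> carrier_mat (m * n) (m * n)"
  by (rule carrier_matI) auto

lemma ensemble_single: "V \<in> carrier_mat m n \<Longrightarrow> ensemble (m * n) [V] = proj (vecm V)"
  using proj_vecm_carrier[of V m n] by (simp add: ensemble_def)

lemma mtrace_ensemble:
  assumes "set Vs \<subseteq> carrier_mat m n"
  shows "mtrace (ensemble (m * n) Vs) = of_real (\<Sum>V\<leftarrow>Vs. fro V)"
proof -
  have "mtrace (ensemble (m * n) Vs) = (\<Sum>V\<leftarrow>Vs. mtrace (proj (vecm V)))"
    unfolding ensemble_def
    by (subst mtrace_msum) (use assms in \<open>auto simp: comp_def proj_vecm_carrier\<close>)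
  also have "\<dots> = of_real (\<Sum>V\<leftarrow>Vs. fro V)"
    by (induction Vs) (auto simp: trace_proj_vecm)
  finally show ?thesis .
qed

lemma act_simps [simp]:
  "act bs [] = []"
  "act bs (V # Vs) = map (\<lambda>(A, B). A * V * B\<^sup>T) bs @ act bs Vs"
  by (simp_all add: act_def)

text \<open>Each Kraus pair sends a rank-one projection to a rank-one projection, so mixtures never
  leave the picture of coefficient matrices.\<close>

lemma local_map_ensemble:
  assumes "\<And>A B. (A, B) \<in> set bs \<Longrightarrow> A \<in> carrier_mat m' m \<and> B \<in> carrier_mat n' n"
    and "set Vs \<subseteq> carrier_mat m n"
  shows "local_map (m' * n') bs (ensemble (m * n) Vs) = ensemble (m' * n') (act bs Vs)"
  using assms(1)
proof (induction bs)
  case Nil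
  have "act [] Vs = []" by (simp add: act_def)
  then show ?case by (simp add: local_map_def ensemble_def)
next
  case (Cons b bs)
  obtain A B where b: "b = (A, B)" by fastforce
  have AB: "A \<in> carrier_mat m' m" "B \<in> carrier_mat n' n" using Cons.prems b by auto
  have d: "dim_row A * dim_row B = m' * n'" "dim_col A * dim_col B = m * n"
    using AB by auto
  have "kron A B * ensemble (m * n) Vs * mat_adjoint (kron A B) =
      msum (m' * n') (map (\<lambda>V. kron A B * proj (vecm V) * mat_adjoint (kron A B)) Vs)"
    unfolding ensemble_def
    by (subst msum_sandwich[of _ "m' * n'"]) (use assms(2) AB in \<open>auto simp: comp_def proj_vecm_carrier\<close>)
  also have "map (\<lambda>V. kron A B * proj (vecm V) * mat_adjoint (kron A B)) Vs =
      map (\<lambda>V. proj (vecm (A * V * B\<^sup>T))) Vs"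
    using assms(2) AB by (intro map_cong) (auto intro!: kron_mult_proj_vecm)
  finally have 1: "kron A B * ensemble (m * n) Vs * mat_adjoint (kron A B) =
      ensemble (m' * n') (map (\<lambda>V. A * V * B\<^sup>T) Vs)"
    by (simp add: ensemble_def comp_def)
  have "local_map (m' * n') (b # bs) (ensemble (m * n) Vs) =
      ensemble (m' * n') (map (\<lambda>V. A * V * B\<^sup>T) Vs) + ensemble (m' * n') (act bs Vs)"
    using Cons.IH[OF Cons.prems] 1 by (simp add: local_map_def b)
  also have "\<dots> = ensemble (m' * n') (act (b # bs) Vs)"
  \<comment> \<open>\<open>act\<close> runs over the inputs first, so the outputs of
    \<open>b\<close> are interleaved with those of \<open>bs\<close>: the lists differ in order, and
    sums of entries are compared instead.\<close>
  proof (rule eq_matI)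
    fix i j assume "i < dim_row (ensemble (m' * n') (act (b # bs) Vs))"
      "j < dim_col (ensemble (m' * n') (act (b # bs) Vs))"
    then have ij: "i < m' * n'" "j < m' * n'" by (simp_all add: ensemble_def)
    have "(\<Sum>V\<leftarrow>map (\<lambda>V. A * V * B\<^sup>T) Vs. proj (vecm V) $$ (i, j)) +
        (\<Sum>V\<leftarrow>act bs Vs. proj (vecm V) $$ (i, j)) =
        (\<Sum>V\<leftarrow>act (b # bs) Vs. proj (vecm V) $$ (i, j))"
      by (induction Vs) (simp_all add: b add.assoc add.left_commute)
    then show "(ensemble (m' * n') (map (\<lambda>V. A * V * B\<^sup>T) Vs) + ensemble (m' * n') (act bs Vs)) $$ (i, j)
        = ensemble (m' * n') (act (b # bs) Vs) $$ (i, j)"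
      using ij by (simp add: ensemble_index del: act_simps)
  qed (auto simp: ensemble_def)
  finally show ?case .
qed

section \<open>Measurements and LOCC protocols\<close>

text \<open>One list product for Kronecker factors, composites and operator pairs alike, so that
  exchange of sums and passage to sublists are treated once. The second list runs fastest, as in
  \<open>parallel\<close> and \<open>discard_ops\<close>.\<close>

definition combine :: "('a \<Rightarrow> 'b \<Rightarrow> 'c) \<Rightarrow> 'a list \<Rightarrow> 'b list \<Rightarrow> 'c list" where
  "combine f xs ys = [f x y. x \<leftarrow> xs, y \<leftarrow> ys]"

lemma combine_simps [simp]:
  "combine f [] ys = []" "combine f (x # xs) ys = map (f x) ys @ combine f xs ys"
  by (simp_all add: combine_def)

lemma set_combine [simp]: "set (combine f xs ys) = {f x y | x y. x \<in> set xs \<and> y \<in> set ys}"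
  by (auto simp: combine_def)

lemma sum_list_combine: "(\<Sum>z\<leftarrow>combine f xs ys. h z) = (\<Sum>x\<leftarrow>xs. \<Sum>y\<leftarrow>ys. h (f x y))"
  by (induction xs) (auto simp: comp_def)

lemma sum_list_combine': "sum_list (combine f xs ys) = (\<Sum>x\<leftarrow>xs. \<Sum>y\<leftarrow>ys. f x y)"
  by (induction xs) auto

lemma map_combine: "map h (combine f xs ys) = combine (\<lambda>x y. h (f x y)) xs ys"
  by (induction xs) auto

lemma sum_list_exchange:
  fixes f :: "'a \<Rightarrow> 'b \<Rightarrow> 'c::comm_monoid_add"
  shows "(\<Sum>x\<leftarrow>xs. \<Sum>y\<leftarrow>ys. f x y) = (\<Sum>y\<leftarrow>ys. \<Sum>x\<leftarrow>xs. f x y)"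
  by (induction xs) (auto simp: sum_list_addf)

text \<open>Successful outcomes are kept as sublists of complete measurements; this carries the
  selection over to products.\<close>

lemma subseq_combine:
  assumes "subseq xs xs'" "subseq ys ys'"
  shows "subseq (combine f xs ys) (combine f xs' ys')"
  using assms(1)
proof (induction rule: list_emb.induct)
  case (list_emb_Cons xs xs' x)
  then show ?case by (simp add: subseq_drop_many)
next
  case (list_emb_Cons2 x y xs xs')
  then show ?case by (auto intro!: list_emb_append_mono subseq_map assms(2))
qed simp

lemma sum_list_subseq_le:
  fixes f :: "'a \<Rightarrow> real"
  assumes "subseq xs ys" "\<And>x. 0 \<le> f x"
  shows "(\<Sum>x\<leftarrow>xs. f x) \<le> (\<Sum>y\<leftarrow>ys. f y)"
  using assms(1)
  by (induction rule: list_emb.induct) (auto intro: add_increasing assms(2) intro!: sum_list_nonneg)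

lemma msum_combine:
  assumes "\<And>x y. x \<in> set xs \<Longrightarrow> y \<in> set ys \<Longrightarrow> f x y \<in> carrier_mat d d"
  shows "msum d (combine f xs ys) = msum d (map (\<lambda>x. msum d (map (f x) ys)) xs)"
  unfolding combine_def using assms by (subst msum_concat) (auto simp: comp_def)

section \<open>Completeness of measurements under composition and tensor products\<close>

lemma gram_carrier: "dim_col K = d \<Longrightarrow> mat_adjoint K * K \<in> carrier_mat d d"
  by (rule carrier_matI) auto

lemma measurementD:
  assumes "measurement d Ks"
  shows "K \<in> set Ks \<Longrightarrow> dim_col K = d" "msum d (map (\<lambda>K. mat_adjoint K * K) Ks) = 1\<^sub>m d"
  using assms by (auto simp: measurement_def)

text \<open>The completeness relation conjugated by \<open>A\<close>: a measurement made after
  \<open>A\<close> leaves the Gram matrix of \<open>A\<close> unchanged in total. Sequential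
  composition and conservation of probability both rest on it.\<close>

lemma measurement_sandwich:
  assumes "measurement d Ks" "dim_row A = d"
  shows "msum (dim_col A) (map (\<lambda>K. mat_adjoint (K * A) * (K * A)) Ks) = mat_adjoint A * A"
proof -
  define n where "n = dim_col A"
  have A: "A \<in> carrier_mat d n" using assms(2) n_def by auto
  have "mat_adjoint (K * A) * (K * A) = mat_adjoint A * (mat_adjoint K * K) * A" if "K \<in> set Ks" for K
    using measurementD(1)[OF assms(1) that] assms(2) by (simp add: adjoint_mult mat_mult_assoc)
  then have m: "map (\<lambda>K. mat_adjoint (K * A) * (K * A)) Ks =
      map (\<lambda>M. mat_adjoint A * M * A) (map (\<lambda>K. mat_adjoint K * K) Ks)"
    by simp
  have "msum n (map (\<lambda>K. mat_adjoint (K * A) * (K * A)) Ks) =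
      mat_adjoint A * msum d (map (\<lambda>K. mat_adjoint K * K) Ks) * A"
    unfolding m by (subst msum_sandwich[of _ n d])
      (use A measurementD(1)[OF assms(1)] in \<open>auto intro!: gram_carrier\<close>)
  then show ?thesis
    unfolding n_def[symmetric]
    using measurementD(2)[OF assms(1)] right_mult_one_mat[OF adjoint_carrier[OF A]] by simp
qed

lemma measurement_combine_mult:
  assumes "measurement d As" "\<And>A. A \<in> set As \<Longrightarrow> dim_row A = d'" "measurement d' Bs"
  shows "measurement d (combine (\<lambda>B A. B * A) Bs As)"
proof -
  note c = measurementD(1)[OF assms(1)] measurementD(1)[OF assms(3)]
  \<comment> \<open>Exchanging the two sums puts the later measurement \<open>Bs\<close> innermost,
    where its completeness applies for each fixed \<open>A\<close>.\<close>
  have "msum d (map (\<lambda>K. mat_adjoint K * K) (combine (\<lambda>B A. B * A) Bs As)) =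
      msum d (combine (\<lambda>A B. mat_adjoint (B * A) * (B * A)) As Bs)"
    by (rule eq_matI) (auto simp: msum_index map_combine sum_list_combine' intro: sum_list_exchange)
  also have "\<dots> = msum d (map (\<lambda>A. msum d (map (\<lambda>B. mat_adjoint (B * A) * (B * A)) Bs)) As)"
    using c by (subst msum_combine) (auto intro!: gram_carrier)
  also have "map (\<lambda>A. msum d (map (\<lambda>B. mat_adjoint (B * A) * (B * A)) Bs)) As =
      map (\<lambda>A. mat_adjoint A * A) As"
    using measurement_sandwich[OF assms(3)] assms(2) c by (intro map_cong) auto
  finally show ?thesis
    using measurementD(2)[OF assms(1)] c by (auto simp: measurement_def)
qed

lemma measurement_combine_kron:
  assumes "measurement m As" "measurement n Bs"
  shows "measurement (m * n) (combine kron As Bs)"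
proof -
  note c = measurementD(1)[OF assms(1)] measurementD(1)[OF assms(2)]
  have "msum (m * n) (map (\<lambda>K. mat_adjoint K * K) (combine kron As Bs)) =
      msum (m * n) (combine (\<lambda>A B. kron (mat_adjoint A * A) (mat_adjoint B * B)) As Bs)"
    by (simp add: map_combine kron_adjoint kron_mult)
  also have "\<dots> = msum (m * n) (map (\<lambda>A. msum (m * n)
      (map (\<lambda>B. kron (mat_adjoint A * A) (mat_adjoint B * B)) Bs)) As)"
    using c by (subst msum_combine) (auto intro!: kron_carrier gram_carrier)
  also have "map (\<lambda>A. msum (m * n) (map (\<lambda>B. kron (mat_adjoint A * A) (mat_adjoint B * B)) Bs)) As =
      map (\<lambda>A. kron (mat_adjoint A * A) (1\<^sub>m n)) As"
  proof (rule map_cong[OF refl])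
    fix A assume "A \<in> set As"
    then have "msum (m * n) (map (kron (mat_adjoint A * A)) (map (\<lambda>B. mat_adjoint B * B) Bs)) =
        kron (mat_adjoint A * A) (msum n (map (\<lambda>B. mat_adjoint B * B) Bs))"
      using c by (subst msum_kron_right) (auto intro!: gram_carrier)
    then show "msum (m * n) (map (\<lambda>B. kron (mat_adjoint A * A) (mat_adjoint B * B)) Bs) =
        kron (mat_adjoint A * A) (1\<^sub>m n)"
      using measurementD(2)[OF assms(2)] by (simp add: comp_def)
  qed
  also have "msum (m * n) (map (\<lambda>A. kron (mat_adjoint A * A) (1\<^sub>m n)) As) =
      kron (msum m (map (\<lambda>A. mat_adjoint A * A) As)) (1\<^sub>m n)"
    using c by (subst msum_kron_left) (auto simp: comp_def intro!: gram_carrier)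
  finally show ?thesis
    using measurementD(2)[OF assms(1)] c by (auto simp: measurement_def kron_one)
qed

text \<open>Conservation of probability in one measurement. \<open>Y\<close> may have any number of
  columns, so the lemma applies to one side of a bipartite coefficient matrix.\<close>

lemma measurement_fro:
  assumes "measurement d Ks" "dim_row Y = d"
  shows "(\<Sum>K\<leftarrow>Ks. fro (K * Y)) = fro Y"
proof -
  have "complex_of_real (\<Sum>K\<leftarrow>Ks. fro (K * Y)) = (\<Sum>K\<leftarrow>Ks. mtrace (mat_adjoint (K * Y) * (K * Y)))"
    by (induction Ks) (auto simp: fro_eq_mtrace)
  also have "\<dots> = mtrace (msum (dim_col Y) (map (\<lambda>K. mat_adjoint (K * Y) * (K * Y)) Ks))"
    by (subst mtrace_msum) (auto simp: comp_def intro!: gram_carrier)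
  also have "\<dots> = complex_of_real (fro Y)"
    by (simp only: measurement_sandwich[OF assms] fro_eq_mtrace)
  finally show ?thesis by (simp only: of_real_eq_iff)
qed

text \<open>The successful outcomes of a local measurement. They form a sublist and not a subset,
  since operators may repeat and \<open>locc_instrument\<close> selects by position; the output
  dimension is imposed on failed outcomes too, because \<open>locc_instrument\<close> asks it of
  every history.\<close>

definition submeasurement :: "nat \<Rightarrow> nat \<Rightarrow> complex mat list \<Rightarrow> bool" where
  "submeasurement d d' As \<longleftrightarrow>
     (\<exists>Ms. measurement d Ms \<and> subseq As Ms \<and> (\<forall>A \<in> set Ms. dim_row A = d'))"

lemma submeasurement_mult:
  assumes "submeasurement d d' As" "submeasurement d' d'' Bs"
  shows "submeasurement d d'' (combine (\<lambda>B A. B * A) Bs As)"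
proof -
  obtain Ms Ns where "measurement d Ms" "subseq As Ms" "\<forall>A \<in> set Ms. dim_row A = d'"
    "measurement d' Ns" "subseq Bs Ns" "\<forall>B \<in> set Ns. dim_row B = d''"
    using assms unfolding submeasurement_def by blast
  then show ?thesis unfolding submeasurement_def
    by (intro exI[of _ "combine (\<lambda>B A. B * A) Ns Ms"])
      (auto intro: measurement_combine_mult subseq_combine)
qed

lemma submeasurement_kron:
  assumes "submeasurement m m' As" "submeasurement n n' Bs"
  shows "submeasurement (m * n) (m' * n') (combine kron As Bs)"
proof -
  obtain Ms Ns where "measurement m Ms" "subseq As Ms" "\<forall>A \<in> set Ms. dim_row A = m'"
    "measurement n Ns" "subseq Bs Ns" "\<forall>B \<in> set Ns. dim_row B = n'"
    using assms unfolding submeasurement_def by blast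
  then show ?thesis unfolding submeasurement_def
    by (intro exI[of _ "combine kron Ms Ns"])
      (auto intro: measurement_combine_kron subseq_combine)
qed

lemma submeasurement_carrier:
  assumes "submeasurement d d' As" "A \<in> set As"
  shows "A \<in> carrier_mat d' d"
proof -
  obtain Ms where Ms: "measurement d Ms" "subseq As Ms" "\<forall>A \<in> set Ms. dim_row A = d'"
    using assms(1) unfolding submeasurement_def by blast
  have "A \<in> set Ms" using list_emb_set[OF Ms(2) assms(2)] by blast
  then show ?thesis using Ms(1,3) measurementD(1) by (intro carrier_matI) auto
qed

text \<open>Alice measures on the trivial history, and Bob then makes one and the same measurement
  after each of her outcomes.\<close>

lemma locc_product:
  assumes A: "measurement dA As" and B: "measurement dB Bs"
  shows "locc_protocol dA dB (combine Pair As Bs)"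
proof -
  have "locc_protocol dA dB ([] @ map (\<lambda>K. (K * 1\<^sub>m dA, 1\<^sub>m dB)) As @ [])"
    using A by (intro locc_protocol.alice) (auto intro: locc_protocol.start)
  also have "map (\<lambda>K. (K * 1\<^sub>m dA, 1\<^sub>m dB)) As = map (\<lambda>K. (K, 1\<^sub>m dB)) As"
    using measurementD(1)[OF A] by auto
  finally have 1: "locc_protocol dA dB ([] @ map (\<lambda>K. (K, 1\<^sub>m dB)) As)" by simp
  \<comment> \<open>Histories are extended one at a time: \<open>xs\<close> collects those that Bob
    has already extended, the others still carry his identity.\<close>
  have "locc_protocol dA dB (xs @ map (\<lambda>K. (K, 1\<^sub>m dB)) As) \<Longrightarrow>
      locc_protocol dA dB (xs @ combine Pair As Bs)" for xs
  proof (induction As arbitrary: xs)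
    case (Cons A As)
    have "locc_protocol dA dB (xs @ map (\<lambda>K. (A, K * 1\<^sub>m dB)) Bs @ map (\<lambda>K. (K, 1\<^sub>m dB)) As)"
      using Cons.prems B by (intro locc_protocol.bob) auto
    moreover have "map (\<lambda>K. (A, K * 1\<^sub>m dB)) Bs = map (Pair A) Bs"
      using measurementD(1)[OF B] by auto
    ultimately show ?case using Cons.IH[of "xs @ map (Pair A) Bs"] by simp
  qed simp
  from this[OF 1] show ?thesis by simp
qed

text \<open>The sublist of successful pairs is read off by an index set \<open>I\<close>, whose
  complement supplies the failure branch \<open>E'\<close>.\<close>

lemma locc_instrument_product:
  assumes "submeasurement dA dA' As" "submeasurement dB dB' Bs"
    and E: "\<And>\<rho>. \<rho> \<in> carrier_mat (dA * dB) (dA * dB) \<Longrightarrow>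
      E \<rho> = local_map (dA' * dB') (combine Pair As Bs) \<rho>"
  shows "\<exists>E'. locc_instrument dA dB dA' dB' E E'"
proof -
  obtain Ms Ns where M: "measurement dA Ms" "subseq As Ms" "\<forall>A \<in> set Ms. dim_row A = dA'"
    and N: "measurement dB Ns" "subseq Bs Ns" "\<forall>B \<in> set Ns. dim_row B = dB'"
    using assms unfolding submeasurement_def by blast
  have "subseq (combine Pair As Bs) (combine Pair Ms Ns)"
    using M N by (intro subseq_combine)
  then obtain I where "combine Pair As Bs = nths (combine Pair Ms Ns) I"
    unfolding subseq_conv_nths by blast
  then have "locc_instrument dA dB dA' dB' E (local_map (dA' * dB') (nths (combine Pair Ms Ns) (- I)))"
    unfolding locc_instrument_def using M N E
    by (intro exI[of _ "combine Pair Ms Ns"] exI[of _ I]) (auto intro: locc_product)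
  then show ?thesis by blast
qed

lemma locc_protocol_dims:
  assumes "locc_protocol dA dB bs"
  shows "(A, B) \<in> set bs \<Longrightarrow> dim_col A = dA \<and> dim_col B = dB"
  using assms by (induction arbitrary: A B rule: locc_protocol.induct) fastforce+

text \<open>The invariant of all LOCC protocols: extending a history by a measurement splits its
  squared norm among the new histories without changing the total. It holds for every
  \<open>X\<close>, which leaves the choice of test matrices free.\<close>

lemma locc_protocol_fro:
  assumes "locc_protocol dA dB bs" "X \<in> carrier_mat dA dB"
  shows "(\<Sum>(A, B)\<leftarrow>bs. fro (A * X * B\<^sup>T)) = fro X"
  using assms(1)
proof (induction rule: locc_protocol.induct)
  case start
  then show ?case using assms(2) by (simp add: transpose_one)
next
  case (alice xs A B ys Ks)
  have d: "dim_col A = dA" "dim_col B = dB"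
    using locc_protocol_dims[OF alice.hyps(1)] by auto
  have "(\<Sum>K\<leftarrow>Ks. fro (K * A * X * B\<^sup>T)) = (\<Sum>K\<leftarrow>Ks. fro (K * (A * X * B\<^sup>T)))"
    using measurementD(1)[OF alice.hyps(2)] d assms(2)
    by (intro arg_cong[of _ _ sum_list] map_cong refl) (simp add: mat_mult_assoc)
  also have "\<dots> = fro (A * X * B\<^sup>T)"
    by (rule measurement_fro[OF alice.hyps(2)]) simp
  finally show ?case using alice.IH by (simp add: comp_def)
next
  case (bob xs A B ys Ks)
  have d: "dim_col A = dA" "dim_col B = dB"
    using locc_protocol_dims[OF bob.hyps(1)] by auto
  \<comment> \<open>Bob multiplies from the right; transposing turns this into a left
    multiplication, to which \<open>measurement_fro\<close> applies, and \<open>fro\<close> is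
    invariant under transposition.\<close>
  have "(\<Sum>K\<leftarrow>Ks. fro (A * X * (K * B)\<^sup>T)) = (\<Sum>K\<leftarrow>Ks. fro (K * (A * X * B\<^sup>T)\<^sup>T))"
  proof (intro arg_cong[of _ _ sum_list] map_cong refl)
    fix K assume "K \<in> set Ks"
    then have K: "dim_col K = dim_row B" using measurementD(1)[OF bob.hyps(2)] by auto
    have t: "(P * Q)\<^sup>T = Q\<^sup>T * P\<^sup>T" if "dim_col P = dim_row Q" for P Q :: "complex mat"
      by (rule transpose_mult) (use that in auto)
    have "A * X * (K * B)\<^sup>T = A * X * (B\<^sup>T * K\<^sup>T)"
      using K by (simp add: t)
    also have "\<dots> = A * X * B\<^sup>T * K\<^sup>T"
      using K d assms(2) by (simp add: mat_mult_assoc)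
    also have "\<dots> = (K * (A * X * B\<^sup>T)\<^sup>T)\<^sup>T"
      using K by (subst t) auto
    finally show "fro (A * X * (K * B)\<^sup>T) = fro (K * (A * X * B\<^sup>T)\<^sup>T)"
      by simp
  qed
  also have "\<dots> = fro ((A * X * B\<^sup>T)\<^sup>T)"
    by (rule measurement_fro[OF bob.hyps(2)]) simp
  finally show ?case using bob.IH by (simp add: comp_def)
qed

text \<open>All that the upper bounds use of an LOCC map: a Kraus list \<open>cs\<close> of product
  form that does not increase norms. The inequality comes from dropping failed histories in
  \<open>locc_protocol_fro\<close>.\<close>

lemma locc_instrument_pure:
  assumes "locc_instrument dA dB dA' dB' E E'"
  obtains cs where
    "\<And>A B. (A, B) \<in> set cs \<Longrightarrow> A \<in> carrier_mat dA' dA \<and> B \<in> carrier_mat dB' dB"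
    "\<And>X. X \<in> carrier_mat dA dB \<Longrightarrow> E (proj (vecm X)) = ensemble (dA' * dB') (act cs [X])"
    "\<And>X. X \<in> carrier_mat dA dB \<Longrightarrow> (\<Sum>V\<leftarrow>act cs [X]. fro V) \<le> fro X"
proof -
  obtain bs I where bs: "locc_protocol dA dB bs"
    and dims: "\<forall>(A, B) \<in> set bs. dim_row A = dA' \<and> dim_row B = dB'"
    and E: "\<forall>\<rho> \<in> carrier_mat (dA * dB) (dA * dB). E \<rho> = local_map (dA' * dB') (nths bs I) \<rho>"
    using assms unfolding locc_instrument_def by blast
  let ?cs = "nths bs I"
  have carrier: "A \<in> carrier_mat dA' dA \<and> B \<in> carrier_mat dB' dB" if "(A, B) \<in> set ?cs" for A B
  proof -
    have "(A, B) \<in> set bs" using that notin_set_nthsI by metis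
    then show ?thesis using dims locc_protocol_dims[OF bs] by (auto intro!: carrier_matI)
  qed
  show thesis
  proof (rule that[of ?cs])
    fix X :: "complex mat" assume X: "X \<in> carrier_mat dA dB"
    have "E (proj (vecm X)) = local_map (dA' * dB') ?cs (ensemble (dA * dB) [X])"
      using E X by (simp add: proj_vecm_carrier ensemble_single)
    then show "E (proj (vecm X)) = ensemble (dA' * dB') (act ?cs [X])"
      using local_map_ensemble[of ?cs dA' dA dB' dB "[X]"] carrier X by auto
    have "(\<Sum>V\<leftarrow>act ?cs [X]. fro V) = (\<Sum>(A, B)\<leftarrow>?cs. fro (A * X * B\<^sup>T))"
      by (simp add: comp_def case_prod_unfold)
    also have "\<dots> \<le> (\<Sum>(A, B)\<leftarrow>bs. fro (A * X * B\<^sup>T))"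
      by (rule sum_list_subseq_le) (auto simp: subseq_conv_nths)
    finally show "(\<Sum>V\<leftarrow>act ?cs [X]. fro V) \<le> fro X"
      using locc_protocol_fro[OF bs X] by simp
  qed (use carrier in auto)
qed

section \<open>Composition and parallel use of maps given by product operators\<close>

lemma local_map_index:
  "i < d \<Longrightarrow> j < d \<Longrightarrow> local_map d bs \<rho> $$ (i, j) =
    (\<Sum>(A, B)\<leftarrow>bs. (kron A B * \<rho> * mat_adjoint (kron A B)) $$ (i, j))"
  by (simp add: local_map_def msum_index comp_def case_prod_unfold)

lemma local_map_carrier [simp, intro]: "local_map d bs \<rho> \<in> carrier_mat d d"
  by (simp add: local_map_def)

lemma local_map_product_compose:
  assumes As: "set As \<subseteq> carrier_mat m' m" and Bs: "set Bs \<subseteq> carrier_mat n' n"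
    and Cs: "set Cs \<subseteq> carrier_mat m'' m'" and Ds: "set Ds \<subseteq> carrier_mat n'' n'"
    and \<rho>: "\<rho> \<in> carrier_mat (m * n) (m * n)"
  shows "local_map (m'' * n'') (combine Pair Cs Ds) (local_map (m' * n') (combine Pair As Bs) \<rho>) =
    local_map (m'' * n'') (combine Pair (combine (\<lambda>C A. C * A) Cs As) (combine (\<lambda>D B. D * B) Ds Bs)) \<rho>"
    (is "?L = ?R")
proof (rule eq_matI)
  fix i j assume "i < dim_row ?R" "j < dim_col ?R"
  then have ij: "i < m'' * n''" "j < m'' * n''" by (auto simp: local_map_def)
  let ?t = "\<lambda>A B \<rho>. kron A B * \<rho> * mat_adjoint (kron A B)"
  have AB: "?t A B \<rho> \<in> carrier_mat (m' * n') (m' * n')" if "A \<in> set As" "B \<in> set Bs" for A B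
  proof -
    have "A \<in> carrier_mat m' m" "B \<in> carrier_mat n' n" using that As Bs by auto
    then show ?thesis by (intro carrier_matI) simp_all
  qed
  have comp: "?t C D (?t A B \<rho>) = ?t (C * A) (D * B) \<rho>"
    if "A \<in> set As" "B \<in> set Bs" "C \<in> set Cs" "D \<in> set Ds" for A B C D
  proof -
    have d: "dim_col A = m" "dim_row A = m'" "dim_col C = m'" "dim_col B = n" "dim_row B = n'" "dim_col D = n'"
      using that As Bs Cs Ds by auto
    then have "kron (C * A) (D * B) = kron C D * kron A B"
      by (simp add: kron_mult)
    then show ?thesis
      using d \<rho> by (simp add: adjoint_mult mat_mult_assoc)
  qed
  have "?t C D (local_map (m' * n') (combine Pair As Bs) \<rho>) =
      msum (m'' * n'') (combine (\<lambda>A B. ?t (C * A) (D * B) \<rho>) As Bs)"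
    if "C \<in> set Cs" "D \<in> set Ds" for C D
  proof -
    have N: "kron C D \<in> carrier_mat (m'' * n'') (m' * n')" using that Cs Ds by auto
    have "?t C D (local_map (m' * n') (combine Pair As Bs) \<rho>) =
        msum (m'' * n'') (combine (\<lambda>A B. ?t C D (?t A B \<rho>)) As Bs)"
      unfolding local_map_def
      by (subst msum_sandwich[OF N]) (use N AB in \<open>auto simp: map_combine\<close>)
    also have "combine (\<lambda>A B. ?t C D (?t A B \<rho>)) As Bs = combine (\<lambda>A B. ?t (C * A) (D * B) \<rho>) As Bs"
      unfolding combine_def using comp that by (intro arg_cong[of _ _ concat] map_cong refl) auto
    finally show ?thesis .
  qed
  then have "?L $$ (i, j) = (\<Sum>C\<leftarrow>Cs. \<Sum>D\<leftarrow>Ds. \<Sum>A\<leftarrow>As. \<Sum>B\<leftarrow>Bs. ?t (C * A) (D * B) \<rho> $$ (i, j))"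
    using ij by (simp add: local_map_index sum_list_combine msum_index cong: map_cong)
  \<comment> \<open>The right-hand side runs through Alice's composites before Bob's, so the sums
    over \<open>D\<close> and \<open>A\<close> are exchanged.\<close>
  also have "\<dots> = ?R $$ (i, j)"
    using ij by (simp add: local_map_index sum_list_combine) (subst sum_list_exchange, rule refl)
  finally show "?L $$ (i, j) = ?R $$ (i, j)" .
qed (auto simp: local_map_def)

lemma parallel_combine:
  "Defs.parallel bs = combine (\<lambda>b c. (kron (fst b) (fst c), kron (snd b) (snd c))) bs bs"
  by (simp add: Defs.parallel_def combine_def case_prod_unfold)

text \<open>\<open>parallel\<close> groups operators by pair of copies; regrouping them by party
  shows that the result is again of product form.\<close>

lemma local_map_parallel_product:
  "local_map d (Defs.parallel (combine Pair As Bs)) \<rho> =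
   local_map d (combine Pair (combine kron As As) (combine kron Bs Bs)) \<rho>" (is "?L = ?R")
proof (rule eq_matI)
  fix i j assume "i < dim_row ?R" "j < dim_col ?R"
  then have ij: "i < d" "j < d" by (auto simp: local_map_def)
  then show "?L $$ (i, j) = ?R $$ (i, j)"
    by (simp add: local_map_index parallel_combine sum_list_combine) (subst sum_list_exchange, rule refl)
qed (auto simp: local_map_def)

section \<open>Copies and parallel application\<close>

definition mat2 :: "complex \<Rightarrow> complex \<Rightarrow> complex \<Rightarrow> complex \<Rightarrow> complex mat" where
  "mat2 x y z w = mat 2 2 (\<lambda>(i, j). [x, y, z, w] ! (2 * i + j))"

lemma mat2_dims [simp]: "dim_row (mat2 x y z w) = 2" "dim_col (mat2 x y z w) = 2"
  by (simp_all add: mat2_def)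

lemma mat2_carrier [simp]: "mat2 x y z w \<in> carrier_mat 2 2"
  by (simp add: mat2_def)

lemma mat2_index [simp]:
  "mat2 x y z w $$ (0, 0) = x" "mat2 x y z w $$ (0, Suc 0) = y"
  "mat2 x y z w $$ (Suc 0, 0) = z" "mat2 x y z w $$ (Suc 0, Suc 0) = w"
  by (simp_all add: mat2_def)

lemma vec_of_list_eq_vecm: "vec_of_list [x, y, z, w] = vecm (mat2 x y z w)"
  by (rule eq_vecI) (auto simp: vecm_index mat2_def vec_of_list_index simp del: vec_of_list_Cons)

lemma less_two_cases: "i < (2::nat) \<Longrightarrow> (i = 0 \<Longrightarrow> P) \<Longrightarrow> (i = Suc 0 \<Longrightarrow> P) \<Longrightarrow> P"
  by fastforce

lemma mat2_eqI:
  assumes "V \<in> carrier_mat 2 2"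
  shows "V = mat2 (V $$ (0, 0)) (V $$ (0, Suc 0)) (V $$ (Suc 0, 0)) (V $$ (Suc 0, Suc 0))"
  by (rule eq_matI) (use assms in \<open>auto elim!: less_two_cases\<close>)

lemma fro_mat2: "fro (mat2 x y z w) = (cmod x)\<^sup>2 + (cmod y)\<^sup>2 + (cmod z)\<^sup>2 + (cmod w)\<^sup>2"
  by (simp add: fro_def numeral_2_eq_2)

lemma vecm_pair: "V \<in> carrier_mat m 2 \<Longrightarrow> a < m \<Longrightarrow> b < 2 \<Longrightarrow> vecm V $ (2 * a + b) = V $$ (a, b)"
proof -
  assume "V \<in> carrier_mat m 2" "a < m" "b < 2"
  moreover from this have "2 * a + b < m * 2" by linarith
  ultimately show ?thesis by (simp add: vecm_index)
qed

text \<open>With Alice's qubits listed before Bob's, \<open>k div 4\<close> is Alice's index and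
  \<open>k mod 4\<close> Bob's, so two copies have a Kronecker product as coefficient matrix;
  \<open>pair_index\<close> gathers the two bits of one copy.\<close>

lemma vecm_kron_pair:
  assumes "V \<in> carrier_mat 2 2" "W \<in> carrier_mat 2 2" "k < 16"
  shows "vecm (kron V W) $ k = vecm V $ pair_index 2 0 k * vecm W $ pair_index 2 1 k"
proof -
  have "k div 4 < 4" using assms(3) by linarith
  moreover have "k mod 4 < 4" by simp
  ultimately have "k div 4 div 2 < 2" "k mod 4 div 2 < 2" by linarith+
  then show ?thesis
    using assms \<open>k div 4 < 4\<close> unfolding pair_index_def qbit_def
    by (simp add: vecm_index[of k] kron_index vecm_pair[of _ 2])
qed

lemma vecm_kron_quadruple:
  assumes "V \<in> carrier_mat 2 2" "k < 256"
  shows "vecm (kron (kron V V) (kron V V)) $ k = (\<Prod>c<4. vecm V $ pair_index 4 c k)"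
proof -
  have q: "vecm V $ pair_index 4 c k = V $$ (qbit 4 c (k div 16), qbit 4 c (k mod 16))" for c
    unfolding pair_index_def using assms by (subst vecm_pair[of _ 2]) (auto simp: qbit_def)
  \<comment> \<open>Unfolding the nested \<open>kron\<close> splits a 4-bit index by 4 and then by
    2, which reads its bits from the most significant one.\<close>
  have bits: "m div 4 div 2 = qbit 4 0 m" "m div 4 mod 2 = qbit 4 1 m"
    "m mod 4 div 2 = qbit 4 2 m" "m mod 4 mod 2 = qbit 4 3 m" if "m < 16" for m
  proof -
    have "m div 8 < 2" using that by linarith
    then have "m div 4 div 2 = m div 8 mod 2" by (simp add: div_mult2_eq[symmetric])
    moreover have "m mod 4 div 2 = m div 2 mod 2"
      using mod_mult2_eq[of m 2 2] by simp
    moreover have "m mod 4 mod 2 = m mod 2" by (rule mod_mod_cancel) simp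
    ultimately
    show "m div 4 div 2 = qbit 4 0 m" "m div 4 mod 2 = qbit 4 1 m"
      "m mod 4 div 2 = qbit 4 2 m" "m mod 4 mod 2 = qbit 4 3 m"
      by (simp_all add: qbit_def)
  qed
  have k: "k div 16 < 16" "k mod 16 < 16" using assms(2) by auto
  have "vecm (kron (kron V V) (kron V V)) $ k = kron (kron V V) (kron V V) $$ (k div 16, k mod 16)"
    using assms by (simp add: vecm_index)
  also have "\<dots> = V $$ (qbit 4 0 (k div 16), qbit 4 0 (k mod 16)) *
      V $$ (qbit 4 1 (k div 16), qbit 4 1 (k mod 16)) *
      (V $$ (qbit 4 2 (k div 16), qbit 4 2 (k mod 16)) * V $$ (qbit 4 3 (k div 16), qbit 4 3 (k mod 16)))"
    unfolding bits[OF k(1), symmetric] bits[OF k(2), symmetric]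
    using assms(1) k by (simp add: kron_index)
  moreover have "{..<4} = {0, 1, 2, 3 :: nat}" by auto
  ultimately show ?thesis
    unfolding q by (simp add: mult.assoc)
qed

lemma pair_index_less: "pair_index n c k < 4"
proof -
  have "qbit n c (k div 2 ^ n) < 2" "qbit n c (k mod 2 ^ n) < 2" by (simp_all add: qbit_def)
  then show ?thesis unfolding pair_index_def by linarith
qed

lemma sum_list_product:
  fixes f :: "'a \<Rightarrow> 'c::comm_semiring_0"
  shows "(\<Sum>x\<leftarrow>xs. f x) * (\<Sum>y\<leftarrow>ys. g y) = (\<Sum>x\<leftarrow>xs. \<Sum>y\<leftarrow>ys. f x * g y)"
  by (simp add: sum_list_const_mult sum_list_mult_const)

text \<open>Two copies of a mixture contain all cross terms \<open>kron V W\<close>. The mixed form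
  is needed because discarding yields a list of branches even where their sum is a pure
  state.\<close>

lemma copies_2_ensemble:
  assumes "set Vs \<subseteq> carrier_mat 2 2"
  shows "copies 2 (ensemble 4 Vs) = ensemble 16 (combine kron Vs Vs)"
proof (rule eq_matI)
  fix k l assume "k < dim_row (ensemble 16 (combine kron Vs Vs))"
    "l < dim_col (ensemble 16 (combine kron Vs Vs))"
  then have kl: "k < 16" "l < 16" by simp_all
  have "proj (vecm (kron V W)) $$ (k, l) = proj (vecm V) $$ (pair_index 2 0 k, pair_index 2 0 l) *
      proj (vecm W) $$ (pair_index 2 1 k, pair_index 2 1 l)" if "V \<in> set Vs" "W \<in> set Vs" for V W
  proof -
    have VW: "V \<in> carrier_mat 2 2" "W \<in> carrier_mat 2 2" using that assms by auto
    then show ?thesis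
      using kl by (simp add: proj_index pair_index_less vecm_kron_pair)
  qed
  then have "ensemble 16 (combine kron Vs Vs) $$ (k, l) =
      (\<Sum>V\<leftarrow>Vs. \<Sum>W\<leftarrow>Vs. proj (vecm V) $$ (pair_index 2 0 k, pair_index 2 0 l) *
        proj (vecm W) $$ (pair_index 2 1 k, pair_index 2 1 l))"
    using kl by (simp add: ensemble_index sum_list_combine cong: map_cong)
  also have "\<dots> = copies 2 (ensemble 4 Vs) $$ (k, l)"
    using kl by (simp add: copies_def numeral_2_eq_2 ensemble_index pair_index_less[unfolded numeral_2_eq_2] flip: sum_list_product)
  finally show "copies 2 (ensemble 4 Vs) $$ (k, l) = ensemble 16 (combine kron Vs Vs) $$ (k, l)" ..
qed (auto simp: copies_def)

lemma copies_2_proj: "V \<in> carrier_mat 2 2 \<Longrightarrow> copies 2 (proj (vecm V)) = proj (vecm (kron V V))"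
  using copies_2_ensemble[of "[V]"] ensemble_single[of V 2 2] ensemble_single[of "kron V V" 4 4]
    kron_carrier[of V 2 2 V 2 2] by simp

lemma copies_4_proj:
  assumes "V \<in> carrier_mat 2 2"
  shows "copies 4 (proj (vecm V)) = proj (vecm (kron (kron V V) (kron V V)))"
  by (rule eq_matI)
    (use assms in \<open>auto simp: copies_def proj_index pair_index_less vecm_kron_quadruple prod.distrib\<close>)

lemma kron_transpose: "(kron A B)\<^sup>T = kron (A\<^sup>T) (B\<^sup>T)"
  by (rule eq_matI) (auto simp: kron_index div_mod_less)

lemma sum_list_act:
  "(\<Sum>V\<leftarrow>act bs Vs. f V) = (\<Sum>V\<leftarrow>Vs. \<Sum>b\<leftarrow>bs. f (fst b * V * (snd b)\<^sup>T))"
  by (induction Vs) (auto simp: comp_def case_prod_unfold)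

lemma act_carrier:
  assumes "\<And>A B. (A, B) \<in> set bs \<Longrightarrow> A \<in> carrier_mat m' m \<and> B \<in> carrier_mat n' n"
  shows "set (act bs Vs) \<subseteq> carrier_mat m' n'"
  using assms by (fastforce simp: act_def)

text \<open>Products \<open>kron V W\<close> evolve factor by factor; the two sides then differ only
  in the order of the sums over \<open>W\<close> and over the operators acting on
  \<open>V\<close>.\<close>

lemma local_map_parallel_ensemble:
  assumes bs: "\<And>A B. (A, B) \<in> set bs \<Longrightarrow> A \<in> carrier_mat m' m \<and> B \<in> carrier_mat n' n"
    and Vs: "set Vs \<subseteq> carrier_mat m n" and Ws: "set Ws \<subseteq> carrier_mat m n"
  shows "local_map (m' * m' * (n' * n')) (Defs.parallel bs) (ensemble (m * m * (n * n)) (combine kron Vs Ws))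
    = ensemble (m' * m' * (n' * n')) (combine kron (act bs Vs) (act bs Ws))" (is "?L = ?R")
proof (rule eq_matI)
  fix i j assume "i < dim_row ?R" "j < dim_col ?R"
  then have ij: "i < m' * m' * (n' * n')" "j < m' * m' * (n' * n')" by simp_all
  let ?f = "\<lambda>V. proj (vecm V) $$ (i, j)"
  have bs': "fst b \<in> carrier_mat m' m" "snd b \<in> carrier_mat n' n" if "b \<in> set bs" for b
    using bs[of "fst b" "snd b"] that by auto
  have "?L = ensemble (m' * m' * (n' * n')) (act (Defs.parallel bs) (combine kron Vs Ws))"
    by (rule local_map_ensemble) (use bs' Vs Ws in \<open>auto simp: parallel_combine intro!: kron_carrier\<close>)
  then have "?L $$ (i, j) = (\<Sum>V\<leftarrow>Vs. \<Sum>W\<leftarrow>Ws. \<Sum>b\<leftarrow>bs. \<Sum>c\<leftarrow>bs.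
      ?f (kron (fst b) (fst c) * kron V W * (kron (snd b) (snd c))\<^sup>T))"
    using ij by (simp add: ensemble_index sum_list_act sum_list_combine parallel_combine)
  also have "\<dots> = (\<Sum>V\<leftarrow>Vs. \<Sum>W\<leftarrow>Ws. \<Sum>b\<leftarrow>bs. \<Sum>c\<leftarrow>bs.
      ?f (kron (fst b * V * (snd b)\<^sup>T) (fst c * W * (snd c)\<^sup>T)))"
  proof -
    have "kron (fst b) (fst c) * kron V W * (kron (snd b) (snd c))\<^sup>T =
        kron (fst b * V * (snd b)\<^sup>T) (fst c * W * (snd c)\<^sup>T)"
      if "V \<in> set Vs" "W \<in> set Ws" "b \<in> set bs" "c \<in> set bs" for V W b c
    proof -
      have "V \<in> carrier_mat m n" "W \<in> carrier_mat m n" using that Vs Ws by auto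
      then show ?thesis
        using bs'[OF that(3)] bs'[OF that(4)] by (simp add: kron_transpose kron_mult)
    qed
    then show ?thesis by (simp cong: map_cong)
  qed
  also have "\<dots> = ?R $$ (i, j)"
    using ij by (simp add: ensemble_index sum_list_act sum_list_combine)
      (subst (2) sum_list_exchange, rule refl)
  finally show "?L $$ (i, j) = ?R $$ (i, j)" .
qed (auto simp: local_map_def)

section \<open>The partial trace over the second qubits and the reduction to two-copy maps\<close>

lemma drop_second_carrier [simp]: "drop_second x \<in> carrier_mat 2 4"
  and drop_second_dims [simp]: "dim_row (drop_second x) = 2" "dim_col (drop_second x) = 4"
  by (simp_all add: drop_second_def)

lemma discard_ops_combine:
  "discard_ops = combine Pair [drop_second 0, drop_second 1] [drop_second 0, drop_second 1]"
  by (simp add: discard_ops_def)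

lemma discard_ops_carrier: "(A, B) \<in> set discard_ops \<Longrightarrow> A \<in> carrier_mat 2 4 \<and> B \<in> carrier_mat 2 4"
  by (auto simp: discard_ops_def)

lemma sym_ops_carrier:
  "set Ks \<subseteq> carrier_mat m n \<Longrightarrow> (A, B) \<in> set (sym_ops Ks) \<Longrightarrow> A \<in> carrier_mat m n \<and> B \<in> carrier_mat m n"
  by (auto simp: sym_ops_def)

lemma stage1_out_ensemble:
  assumes "set Ks \<subseteq> carrier_mat 4 4" "set Vs \<subseteq> carrier_mat 4 4"
  shows "stage1_out Ks (ensemble 16 Vs) = ensemble 4 (act discard_ops (act (sym_ops Ks) Vs))"
proof -
  have "local_map 16 (sym_ops Ks) (ensemble 16 Vs) = ensemble 16 (act (sym_ops Ks) Vs)"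
    using local_map_ensemble[of "sym_ops Ks" 4 4 4 4 Vs] sym_ops_carrier[OF assms(1)] assms(2) by simp
  moreover have "local_map 4 discard_ops (ensemble 16 (act (sym_ops Ks) Vs)) =
      ensemble 4 (act discard_ops (act (sym_ops Ks) Vs))"
    using local_map_ensemble[of discard_ops 2 4 2 4] discard_ops_carrier
      act_carrier[OF sym_ops_carrier[OF assms(1)]] by simp
  ultimately show ?thesis by (simp add: stage1_out_def discard_def)
qed

text \<open>The two pairs evolve independently, so stage 2 receives two copies of the unnormalized
  stage 1 output, whatever the map \<open>E\<close>. Every statement about four copies is reduced to
  two-copy maps here.\<close>

lemma concat_map_pure:
  assumes Ks: "set Ks \<subseteq> carrier_mat 4 4" and V: "V \<in> carrier_mat 2 2"
  shows "concat_map Ks E (copies 4 (proj (vecm V))) =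
    E (copies 2 (stage1_out Ks (copies 2 (proj (vecm V)))))"
proof -
  let ?W = "kron V V"
  let ?Us = "act (sym_ops Ks) [?W]"
  have W: "?W \<in> carrier_mat 4 4" using kron_carrier[OF V V] by simp
  have WW: "kron ?W ?W \<in> carrier_mat 16 16" using kron_carrier[OF W W] by simp
  have Us: "set ?Us \<subseteq> carrier_mat 4 4"
    using act_carrier[OF sym_ops_carrier[OF Ks]] by blast
  have "copies 4 (proj (vecm V)) = ensemble 256 (combine kron [?W] [?W])"
    using ensemble_single[OF WW] by (simp add: copies_4_proj[OF V])
  then have "local_map 256 (Defs.parallel (sym_ops Ks)) (copies 4 (proj (vecm V))) =
      ensemble 256 (combine kron ?Us ?Us)"
    using local_map_parallel_ensemble[of "sym_ops Ks" 4 4 4 4 "[?W]" "[?W]"]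
      sym_ops_carrier[OF Ks] W by simp
  then have "local_map 16 (Defs.parallel discard_ops)
      (local_map 256 (Defs.parallel (sym_ops Ks)) (copies 4 (proj (vecm V)))) =
      ensemble 16 (combine kron (act discard_ops ?Us) (act discard_ops ?Us))"
    using local_map_parallel_ensemble[of discard_ops 2 4 2 4 ?Us ?Us] discard_ops_carrier Us by simp
  also have "\<dots> = copies 2 (ensemble 4 (act discard_ops ?Us))"
    using act_carrier[OF discard_ops_carrier] by (subst copies_2_ensemble) auto
  also have "ensemble 4 (act discard_ops ?Us) = stage1_out Ks (copies 2 (proj (vecm V)))"
    using stage1_out_ensemble[OF Ks, of "[?W]"] W ensemble_single[OF W] by (simp add: copies_2_proj[OF V])
  finally show ?thesis by (simp add: concat_map_def)
qed

text \<open>LOCC maps in which neither party's measurement depends on the other's outcomes. Equality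
  is asked only on matrices of the right size, as in \<open>locc_instrument\<close>.\<close>

definition product_locc :: "nat \<Rightarrow> nat \<Rightarrow> nat \<Rightarrow> nat \<Rightarrow> (complex mat \<Rightarrow> complex mat) \<Rightarrow> bool" where
  "product_locc m n m' n' E \<longleftrightarrow>
     (\<exists>As Bs. submeasurement m m' As \<and> submeasurement n n' Bs \<and>
        (\<forall>\<rho> \<in> carrier_mat (m * n) (m * n). E \<rho> = local_map (m' * n') (combine Pair As Bs) \<rho>))"

lemma product_locc_instrument:
  "product_locc m n m' n' E \<Longrightarrow> \<exists>E'. locc_instrument m n m' n' E E'"
  unfolding product_locc_def using locc_instrument_product by blast

lemma product_loccI:
  "submeasurement m m' As \<Longrightarrow> submeasurement n n' Bs \<Longrightarrow>
   product_locc m n m' n' (local_map (m' * n') (combine Pair As Bs))"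
  unfolding product_locc_def by blast

lemma product_locc_parallel:
  assumes "submeasurement m m' As" "submeasurement n n' Bs"
  shows "product_locc (m * m) (n * n) (m' * m') (n' * n')
    (local_map (m' * m' * (n' * n')) (Defs.parallel (combine Pair As Bs)))"
  unfolding local_map_parallel_product using assms
  by (intro product_loccI submeasurement_kron)

lemma product_locc_compose:
  assumes "product_locc m n m' n' E" "product_locc m' n' m'' n'' F"
  shows "product_locc m n m'' n'' (\<lambda>\<rho>. F (E \<rho>))"
proof -
  obtain As Bs Cs Ds where 1: "submeasurement m m' As" "submeasurement n n' Bs"
      "submeasurement m' m'' Cs" "submeasurement n' n'' Ds"
    and E: "\<forall>\<rho> \<in> carrier_mat (m * n) (m * n). E \<rho> = local_map (m' * n') (combine Pair As Bs) \<rho>"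
    and F: "\<forall>\<rho> \<in> carrier_mat (m' * n') (m' * n'). F \<rho> = local_map (m'' * n'') (combine Pair Cs Ds) \<rho>"
    using assms unfolding product_locc_def by blast
  show ?thesis unfolding product_locc_def
  proof (intro exI conjI ballI)
    fix \<rho> :: "complex mat" assume \<rho>: "\<rho> \<in> carrier_mat (m * n) (m * n)"
    then have "F (E \<rho>) = local_map (m'' * n'') (combine Pair Cs Ds) (local_map (m' * n') (combine Pair As Bs) \<rho>)"
      using E F by simp
    then show "F (E \<rho>) = local_map (m'' * n'')
        (combine Pair (combine (\<lambda>C A. C * A) Cs As) (combine (\<lambda>D B. D * B) Ds Bs)) \<rho>"
      using local_map_product_compose[OF _ _ _ _ \<rho>, of As m' Bs n' Cs m'' Ds n'']
        1[THEN submeasurement_carrier] by (simp add: subset_iff)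
  qed (use 1 in \<open>auto intro: submeasurement_mult\<close>)
qed

section \<open>Action of the stage 1 operators on two copies\<close>

lemma sum_lessThan_4: "(\<Sum>k<4. f k) = f 0 + f 1 + f 2 + f (3::nat)"
proof -
  have "{..<4} = {0, 1, 2, 3 :: nat}" by auto
  then show ?thesis by (simp add: add.assoc)
qed

lemma less_four_cases:
  "i < (4::nat) \<Longrightarrow> (i = 0 \<Longrightarrow> P) \<Longrightarrow> (i = 1 \<Longrightarrow> P) \<Longrightarrow> (i = 2 \<Longrightarrow> P) \<Longrightarrow> (i = 3 \<Longrightarrow> P) \<Longrightarrow> P"
  by fastforce

lemma stage1_kraus_eq:
  "stage1_kraus a b = mat 4 4 (\<lambda>(i, j). if i = 0 \<and> (j = 1 \<or> j = 2) then a
     else if i = 2 \<and> j = 1 then b else if i = 2 \<and> j = 2 then - b else 0)"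
  by (rule eq_matI) (auto simp: stage1_kraus_def ketbra_def elim!: less_four_cases)

lemma stage1_kraus_carrier [simp]: "stage1_kraus a b \<in> carrier_mat 4 4"
  by (simp add: stage1_kraus_eq)

lemma drop_second_mult:
  assumes "M \<in> carrier_mat 4 n" "x < 2"
  shows "drop_second x * M = mat 2 n (\<lambda>(i, j). M $$ (2 * i + x, j))"
proof (rule eq_matI)
  fix i j
  assume "i < dim_row (mat 2 n (\<lambda>(i, j). M $$ (2 * i + x, j)))" "j < dim_col (mat 2 n (\<lambda>(i, j). M $$ (2 * i + x, j)))"
  then have ij: "i < 2" "j < n" by simp_all
  then have "2 * i + x < 4" using assms(2) by linarith
  then have "(drop_second x * M) $$ (i, j) = M $$ (2 * i + x, j)"
    using assms ij
    by (simp add: mult_index drop_second_def if_distrib[where f = "\<lambda>c. c * _"] del: index_mult_mat(1) cong: if_cong)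
  then show "(drop_second x * M) $$ (i, j) = mat 2 n (\<lambda>(i, j). M $$ (2 * i + x, j)) $$ (i, j)"
    using ij by simp
qed (use assms in auto)

lemma drop_0_stage1_kraus:
  "drop_second 0 * stage1_kraus a b = mat 2 4 (\<lambda>(i, j). [0, a, a, 0, 0, b, - b, 0] ! (4 * i + j))"
  by (subst drop_second_mult[OF stage1_kraus_carrier], simp, rule eq_matI)
    (auto elim!: less_two_cases less_four_cases simp: stage1_kraus_eq)

text \<open>Rows 1 and 3 of the operator vanish: success leaves the second qubit of each party in
  |0>. Hence only one of the four discard branches survives.\<close>

lemma drop_1_stage1_kraus: "drop_second 1 * stage1_kraus a b = 0\<^sub>m 2 4"
  by (subst drop_second_mult[OF stage1_kraus_carrier])
    (auto simp: stage1_kraus_eq intro!: eq_matI)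

text \<open>On the span of |01> and |10> two copies have the symmetric block with rows
  \<open>(x w, y z)\<close> and \<open>(y z, x w)\<close>, with eigenvectors (1, 1) and (1, -1). The
  two nonzero rows of the operator are multiples of these, so the output is diagonal and shows the
  eigenvalues; the factor 2 is the squared length of the eigenvectors.\<close>

lemma stage1_branch:
  "drop_second 0 * stage1_kraus a b * kron (mat2 x y z w) (mat2 x y z w) * (drop_second 0 * stage1_kraus a b)\<^sup>T
    = mat2 (2 * a\<^sup>2 * (x * w + y * z)) 0 0 (2 * b\<^sup>2 * (x * w - y * z))"
proof (rule eq_matI)
  fix i j
  assume "i < dim_row (mat2 (2 * a\<^sup>2 * (x * w + y * z)) 0 0 (2 * b\<^sup>2 * (x * w - y * z)))"
    "j < dim_col (mat2 (2 * a\<^sup>2 * (x * w + y * z)) 0 0 (2 * b\<^sup>2 * (x * w - y * z)))"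
  then show "(drop_second 0 * stage1_kraus a b * kron (mat2 x y z w) (mat2 x y z w) *
      (drop_second 0 * stage1_kraus a b)\<^sup>T) $$ (i, j) =
    mat2 (2 * a\<^sup>2 * (x * w + y * z)) 0 0 (2 * b\<^sup>2 * (x * w - y * z)) $$ (i, j)"
    unfolding drop_0_stage1_kraus
    by (subst sandwich_index)
      (auto elim!: less_two_cases simp: sum_lessThan_4 kron_index, (simp add: power2_eq_square algebra_simps)+)
qed (simp_all add: drop_0_stage1_kraus)

lemma stage1_out_pure:
  assumes Ks: "\<forall>K \<in> set Ks. \<exists>a b. K = stage1_kraus a b" and V: "V \<in> carrier_mat 2 2"
  shows "stage1_out Ks (copies 2 (proj (vecm V))) =
    ensemble 4 (map (\<lambda>K. drop_second 0 * K * kron V V * (drop_second 0 * K)\<^sup>T) Ks)" (is "?L = ?R")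
proof (rule eq_matI)
  fix i j assume "i < dim_row ?R" "j < dim_col ?R"
  then have ij: "i < 4" "j < 4" by simp_all
  let ?W = "kron V V"
  let ?f = "\<lambda>V. proj (vecm V) $$ (i, j)"
  have W: "?W \<in> carrier_mat 4 4" using kron_carrier[OF V V] by simp
  have Ks': "set Ks \<subseteq> carrier_mat 4 4" using Ks by auto
  have "copies 2 (proj (vecm V)) = ensemble 16 [?W]"
    using ensemble_single[OF W] by (simp add: copies_2_proj[OF V])
  then have "?L = ensemble 4 (act discard_ops (act (sym_ops Ks) [?W]))"
    using stage1_out_ensemble[OF Ks', of "[?W]"] W by simp
  then have "?L $$ (i, j) = (\<Sum>K\<leftarrow>Ks. \<Sum>(A, B)\<leftarrow>discard_ops. ?f (A * (K * ?W * K\<^sup>T) * B\<^sup>T))"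
    using ij by (simp add: ensemble_index sum_list_act sym_ops_def comp_def case_prod_unfold)
  also have "\<dots> = (\<Sum>K\<leftarrow>Ks. ?f (drop_second 0 * K * ?W * (drop_second 0 * K)\<^sup>T))"
  proof (intro arg_cong[of _ _ sum_list] map_cong refl)
    fix K assume "K \<in> set Ks"
    then obtain a b where K: "K = stage1_kraus a b" using Ks by blast
    have Kc: "K \<in> carrier_mat 4 4" using K by simp
    have A: "A * (K * ?W * K\<^sup>T) * B\<^sup>T = A * K * ?W * (B * K)\<^sup>T"
      if "A \<in> carrier_mat 2 4" "B \<in> carrier_mat 2 4" for A B
      using that Kc W V by (simp add: transpose_mult[of _ 2 4 _ 4] mat_mult_assoc)
    have z: "?f (0\<^sub>m 2 2) = 0" using ij by (simp add: proj_index vecm_index)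
    have d: "drop_second (Suc 0) * K = 0\<^sub>m 2 4" using drop_1_stage1_kraus K by simp
    have zero: "X * 0\<^sub>m 4 2 = 0\<^sub>m 2 2" if "X \<in> carrier_mat 2 4" for X :: "complex mat"
      using that by (rule right_mult_zero_mat)
    have zero': "0\<^sub>m 2 4 * ?W * Y = 0\<^sub>m 2 2" if "Y \<in> carrier_mat 4 2" for Y :: "complex mat"
      using left_mult_zero_mat[OF W, of 2] left_mult_zero_mat[OF that, of 2] by simp
    have "A * K * ?W \<in> carrier_mat 2 4" "(A * K)\<^sup>T \<in> carrier_mat 4 2" if "A \<in> carrier_mat 2 4" for A
      using that Kc W by auto
    then show "(\<Sum>(A, B)\<leftarrow>discard_ops. ?f (A * (K * ?W * K\<^sup>T) * B\<^sup>T)) =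
        ?f (drop_second 0 * K * ?W * (drop_second 0 * K)\<^sup>T)"
      using z d by (simp add: discard_ops_combine A zero zero')
  qed
  finally show "?L $$ (i, j) = ?R $$ (i, j)"
    using ij by (simp add: ensemble_index comp_def)
qed (simp_all add: stage1_out_def discard_def local_map_def)

section \<open>Renormalization and the conclusiveness condition\<close>

lemma mtrace_proj_vec_of_list:
  "mtrace (proj (vec_of_list [x, y, z, w])) =
    of_real ((cmod x)\<^sup>2 + (cmod y)\<^sup>2 + (cmod z)\<^sup>2 + (cmod w)\<^sup>2)"
  unfolding vec_of_list_eq_vecm trace_proj_vecm fro_mat2 ..

text \<open>The trace is \<open>r * r\<close> with \<open>r\<close> real. A vanishing output is
  included: then \<open>r = 0\<close>, and division by zero yields zero on both sides.\<close>

lemma renorm_schmidt: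
  fixes \<alpha> \<beta> :: complex
  defines "r \<equiv> complex_of_real (sqrt ((cmod \<alpha>)\<^sup>2 + (cmod \<beta>)\<^sup>2))"
  shows "renorm (proj (vec_of_list [\<alpha>, 0, 0, \<beta>])) = proj (vec_of_list [\<alpha> / r, 0, 0, \<beta> / r])"
proof -
  have r: "mtrace (proj (vec_of_list [\<alpha>, 0, 0, \<beta>])) = r * r"
    unfolding mtrace_proj_vec_of_list r_def of_real_mult[symmetric]
    by (simp del: of_real_mult)
  have "cnj r = r" by (simp add: r_def)
  then show ?thesis
    unfolding renorm_def r
    by (intro eq_matI) (auto simp: proj_index vec_of_list_index less_Suc_eq
      simp del: vec_of_list_Cons)
qed

lemma phi_plus_expectation:
  assumes "X \<in> carrier_mat 4 4"
  shows "(X *\<^sub>v phi_plus) \<bullet>c phi_plus = (X $$ (0, 0) + X $$ (0, 3) + X $$ (3, 0) + X $$ (3, 3)) / 2"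
proof -
  define s where "s = 1 / complex_of_real (sqrt 2)"
  have s: "s * s = 1 / 2" "cnj s = s"
    by (simp_all add: s_def flip: of_real_mult)
  have phi: "phi_plus $ 0 = s" "phi_plus $ 1 = 0" "phi_plus $ 2 = 0" "phi_plus $ 3 = s" "dim_vec phi_plus = 4"
    by (simp_all add: phi_plus_def s_def vec_of_list_index numeral_3_eq_3 numeral_2_eq_2 del: vec_of_list_Cons)
  have "(X *\<^sub>v phi_plus) \<bullet>c phi_plus = (\<Sum>i<4. (\<Sum>j<4. X $$ (i, j) * phi_plus $ j) * cnj (phi_plus $ i))"
    using assms phi(5) by (simp add: scalar_prod_def atLeast0LessThan)
  also have "\<dots> = (X $$ (0, 0) * s + X $$ (0, 3) * s) * s + (X $$ (3, 0) * s + X $$ (3, 3) * s) * s"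
    unfolding sum_lessThan_4 phi by (simp add: s)
  also have "\<dots> = (X $$ (0, 0) + X $$ (0, 3) + X $$ (3, 0) + X $$ (3, 3)) * (s * s)"
    by (simp add: algebra_simps)
  finally show ?thesis by (simp add: s)
qed

text \<open>The defect \<open>d V\<close> is the squared norm of the component of \<open>V\<close>
  orthogonal to the Bell state. Being nonnegative, defects cannot cancel in a mixture, so
  conclusiveness passes to every single branch.\<close>

lemma conclusive_ensemble_iff:
  assumes Vs: "set Vs \<subseteq> carrier_mat 2 2"
  shows "conclusive (ensemble 4 Vs) \<longleftrightarrow>
    (\<forall>V \<in> set Vs. V $$ (0, 1) = 0 \<and> V $$ (1, 0) = 0 \<and> V $$ (0, 0) = V $$ (1, 1))"
proof -
  define d where "d V = (cmod (V $$ (0, 1)))\<^sup>2 + (cmod (V $$ (1, 0)))\<^sup>2 +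
    (cmod (V $$ (0, 0) - V $$ (1, 1)))\<^sup>2 / 2" for V :: "complex mat"
  have d: "mtrace (proj (vecm V)) - (proj (vecm V) *\<^sub>v phi_plus) \<bullet>c phi_plus = of_real (d V)"
    if "V \<in> set Vs" for V
  proof -
    have V: "V \<in> carrier_mat 2 2" using that Vs by auto
    obtain x y z w where xyzw: "V = mat2 x y z w" using mat2_eqI[OF V] by blast
    have c: "proj (vecm V) \<in> carrier_mat 4 4" using proj_vecm_carrier[OF V] by simp
    have "(proj (vecm V) *\<^sub>v phi_plus) \<bullet>c phi_plus = (x * cnj x + x * cnj w + w * cnj x + w * cnj w) / 2"
      by (subst phi_plus_expectation[OF c]) (simp add: xyzw proj_index vecm_index)
    moreover have "mtrace (proj (vecm V)) = x * cnj x + y * cnj y + z * cnj z + w * cnj w"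
      by (simp add: trace_proj_vecm xyzw fro_mat2 complex_norm_square del: of_real_power)
    moreover have "of_real (d V) = y * cnj y + z * cnj z + (x - w) * cnj (x - w) / 2"
      by (simp add: d_def xyzw complex_norm_square del: of_real_power complex_cnj_diff)
    ultimately show ?thesis by (simp only:) (simp add: field_simps)
  qed
  have exp: "(ensemble 4 Vs *\<^sub>v phi_plus) \<bullet>c phi_plus = (\<Sum>V\<leftarrow>Vs. (proj (vecm V) *\<^sub>v phi_plus) \<bullet>c phi_plus)"
  proof -
    have "(ensemble 4 Vs *\<^sub>v phi_plus) \<bullet>c phi_plus =
      (\<Sum>V\<leftarrow>Vs. (proj (vecm V) $$ (0, 0) + proj (vecm V) $$ (0, 3) + proj (vecm V) $$ (3, 0) + proj (vecm V) $$ (3, 3)) / 2)"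
      unfolding phi_plus_expectation[OF ensemble_carrier]
      by (simp add: ensemble_index add_divide_distrib)
        (induction Vs, auto simp: add_divide_distrib add_ac)
    also have "\<dots> = (\<Sum>V\<leftarrow>Vs. (proj (vecm V) *\<^sub>v phi_plus) \<bullet>c phi_plus)"
      using Vs proj_vecm_carrier[of _ 2 2]
      by (intro arg_cong[of _ _ sum_list] map_cong refl phi_plus_expectation[symmetric]) auto
    finally show ?thesis .
  qed
  have tr: "mtrace (ensemble 4 Vs) = (\<Sum>V\<leftarrow>Vs. mtrace (proj (vecm V)))"
    unfolding ensemble_def using Vs proj_vecm_carrier[of _ 2 2]
    by (subst mtrace_msum) (auto simp: comp_def)
  have "mtrace (ensemble 4 Vs) - (ensemble 4 Vs *\<^sub>v phi_plus) \<bullet>c phi_plus = (\<Sum>V\<leftarrow>Vs. complex_of_real (d V))"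
    unfolding tr exp using d by (induction Vs) (auto simp: algebra_simps)
  also have "\<dots> = complex_of_real (\<Sum>V\<leftarrow>Vs. d V)"
    by (induction Vs) auto
  finally have "conclusive (ensemble 4 Vs) \<longleftrightarrow> (\<Sum>V\<leftarrow>Vs. d V) = 0"
    unfolding conclusive_def
    by (metis eq_iff_diff_eq_0 of_real_eq_0_iff)
  also have "\<dots> \<longleftrightarrow> (\<forall>V \<in> set Vs. d V = 0)"
    by (subst sum_list_nonneg_eq_0_iff) (auto simp: d_def)
  also have "\<dots> \<longleftrightarrow> (\<forall>V \<in> set Vs. V $$ (0, 1) = 0 \<and> V $$ (1, 0) = 0 \<and> V $$ (0, 0) = V $$ (1, 1))"
    by (auto simp: d_def add_nonneg_eq_0_iff)
  finally show ?thesis .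
qed

section \<open>Upper bounds\<close>

lemma fro_ge_entry: "i < dim_row V \<Longrightarrow> j < dim_col V \<Longrightarrow> (cmod (V $$ (i, j)))\<^sup>2 \<le> fro V"
  unfolding fro_def
  by (rule order_trans[OF _ member_le_sum[of i]])
    (auto intro!: member_le_sum[of j] sum_nonneg)

text \<open>An instrument fixes a map but not its Kraus operators, so the list \<open>cs\<close> of
  the protocol may differ from \<open>bs\<close>. Both give the same output, whose trace is either
  sum of squared norms.\<close>

lemma locc_kraus_fro_le:
  assumes "locc_instrument m n m' n' (local_map (m' * n') bs) E'"
    and bs: "\<And>A B. (A, B) \<in> set bs \<Longrightarrow> A \<in> carrier_mat m' m \<and> B \<in> carrier_mat n' n"
    and X: "X \<in> carrier_mat m n"
  shows "(\<Sum>(A, B)\<leftarrow>bs. fro (A * X * B\<^sup>T)) \<le> fro X"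
proof -
  obtain cs where cs: "\<And>A B. (A, B) \<in> set cs \<Longrightarrow> A \<in> carrier_mat m' m \<and> B \<in> carrier_mat n' n"
    and eq: "local_map (m' * n') bs (proj (vecm X)) = ensemble (m' * n') (act cs [X])"
    and le: "(\<Sum>V\<leftarrow>act cs [X]. fro V) \<le> fro X"
    using locc_instrument_pure[OF assms(1)] X by metis
  have "local_map (m' * n') bs (proj (vecm X)) = ensemble (m' * n') (act bs [X])"
    using local_map_ensemble[of bs m' m n' n "[X]"] bs X ensemble_single[OF X] by auto
  then have "mtrace (ensemble (m' * n') (act bs [X])) = mtrace (ensemble (m' * n') (act cs [X]))"
    using eq by simp
  then have "(\<Sum>V\<leftarrow>act bs [X]. fro V) = (\<Sum>V\<leftarrow>act cs [X]. fro V)"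
    using mtrace_ensemble[OF act_carrier[of bs m' m n' n "[X]"]]
      mtrace_ensemble[OF act_carrier[of cs m' m n' n "[X]"]] bs cs
    by (simp only: of_real_eq_iff)
  then show ?thesis using le by (simp add: comp_def case_prod_unfold)
qed

text \<open>The operators \<open>K\<close> interfere constructively on the coefficient matrices below, which yields the
  sharp constraints on the two coefficients of \<open>stage1_kraus\<close>.\<close>

definition flip_mat :: "complex \<Rightarrow> complex mat" where
  "flip_mat e = mat 4 4 (\<lambda>(i, j). if i = j \<and> (i = 1 \<or> i = 2) then 1
     else if i = 1 \<and> j = 2 \<or> i = 2 \<and> j = 1 then e else 0)"

lemma flip_mat_carrier: "flip_mat e \<in> carrier_mat 4 4"
  by (simp add: flip_mat_def)

text \<open>Source of the constants in both bounds: the value 4 at \<open>e = 1\<close> and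
  \<open>e = - 1\<close> limits the stage 1 coefficients, the value 2 at \<open>e = 0\<close>
  becomes the factor in the stage 2 bound.\<close>

lemma fro_flip_mat: "fro (flip_mat e) = 2 + 2 * (cmod e)\<^sup>2"
  by (simp add: fro_def flip_mat_def sum_lessThan_4)

lemma stage1_kraus_flip:
  "(stage1_kraus a b * flip_mat e * (stage1_kraus a b)\<^sup>T) $$ (0, 0) = 2 * a\<^sup>2 * (1 + e)"
  "(stage1_kraus a b * flip_mat e * (stage1_kraus a b)\<^sup>T) $$ (2, 2) = 2 * b\<^sup>2 * (1 - e)"
  by (subst sandwich_index;
      simp add: flip_mat_def stage1_kraus_eq sum_lessThan_4 power2_eq_square algebra_simps)+

text \<open>The entries (0, 1) and (2, 1) read off the coefficients \<open>a\<close> and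
  \<open>b\<close>, which the family provides only existentially.\<close>

lemma stage1_family_coefficients:
  assumes "stage1_family Ks"
  shows "4 * (\<Sum>K\<leftarrow>Ks. cmod (K $$ (0, 1)) ^ 4) \<le> 1" "4 * (\<Sum>K\<leftarrow>Ks. cmod (K $$ (2, 1)) ^ 4) \<le> 1"
proof -
  obtain E' where E': "locc_instrument 4 4 4 4 (local_map (4 * 4) (sym_ops Ks)) E'"
    using assms by (auto simp: stage1_family_def)
  have Ks: "\<exists>a b. K = stage1_kraus a b" if "K \<in> set Ks" for K
    using assms that unfolding stage1_family_def by blast
  then have Kc: "set Ks \<subseteq> carrier_mat 4 4" by (metis stage1_kraus_carrier subsetI)
  have le: "(\<Sum>K\<leftarrow>Ks. fro (K * flip_mat e * K\<^sup>T)) \<le> 2 + 2 * (cmod e)\<^sup>2" for e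
    using locc_kraus_fro_le[OF E' sym_ops_carrier[OF Kc] flip_mat_carrier, of e]
    by (simp add: fro_flip_mat sym_ops_def comp_def)
  have "(\<Sum>K\<leftarrow>Ks. 16 * cmod (K $$ (0, 1)) ^ 4) \<le> (\<Sum>K\<leftarrow>Ks. fro (K * flip_mat 1 * K\<^sup>T))"
  proof (rule sum_list_mono)
    fix K assume "K \<in> set Ks"
    then obtain a b where K: "K = stage1_kraus a b" using Ks by blast
    have "(cmod (4 * a\<^sup>2))\<^sup>2 \<le> fro (K * flip_mat 1 * K\<^sup>T)"
      using fro_ge_entry[of 0 "K * flip_mat 1 * K\<^sup>T" 0] stage1_kraus_flip(1)[of a b 1] K
      by (simp add: stage1_kraus_eq mult.commute)
    then show "16 * cmod (K $$ (0, 1)) ^ 4 \<le> fro (K * flip_mat 1 * K\<^sup>T)"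
      by (simp add: K stage1_kraus_eq norm_mult norm_power power_mult_distrib flip: power_mult)
  qed
  then show "4 * (\<Sum>K\<leftarrow>Ks. cmod (K $$ (0, 1)) ^ 4) \<le> 1"
    using le[of 1] by (simp add: sum_list_const_mult)
  have "(\<Sum>K\<leftarrow>Ks. 16 * cmod (K $$ (2, 1)) ^ 4) \<le> (\<Sum>K\<leftarrow>Ks. fro (K * flip_mat (- 1) * K\<^sup>T))"
  proof (rule sum_list_mono)
    fix K assume "K \<in> set Ks"
    then obtain a b where K: "K = stage1_kraus a b" using Ks by blast
    have "(cmod (4 * b\<^sup>2))\<^sup>2 \<le> fro (K * flip_mat (- 1) * K\<^sup>T)"
      using fro_ge_entry[of 2 "K * flip_mat (- 1) * K\<^sup>T" 2] stage1_kraus_flip(2)[of a b "- 1"] K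
      by (simp add: stage1_kraus_eq mult.commute)
    then show "16 * cmod (K $$ (2, 1)) ^ 4 \<le> fro (K * flip_mat (- 1) * K\<^sup>T)"
      by (simp add: K stage1_kraus_eq norm_mult norm_power power_mult_distrib flip: power_mult)
  qed
  then show "4 * (\<Sum>K\<leftarrow>Ks. cmod (K $$ (2, 1)) ^ 4) \<le> 1"
    using le[of "- 1"] by (simp add: sum_list_const_mult)
qed

text \<open>Several operators may contribute, and their branches add up incoherently. Comparing the
  weights of |00> and |11> with those of the pure output gives |\<alpha>|^2 = 4 (sum |a|^4) |x w + y
  z|^2 and the analogue for \<beta>; phases do not matter, as the stage 2 bound depends on moduli
  only.\<close>

lemma stage1_output_bound:
  assumes fam: "stage1_family Ks"
    and out: "stage1_out Ks (copies 2 (proj (vecm (mat2 x y z w)))) = proj (vec_of_list [\<alpha>, 0, 0, \<beta>])"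
  shows "cmod (\<alpha> * \<beta>) \<le> cmod ((x * w + y * z) * (x * w - y * z))"
proof -
  let ?p = "x * w + y * z" and ?m = "x * w - y * z"
  have Ks: "\<forall>K \<in> set Ks. \<exists>a b. K = stage1_kraus a b"
    using fam unfolding stage1_family_def by blast
  let ?W = "\<lambda>K. mat2 (2 * (K $$ (0, 1))\<^sup>2 * ?p) 0 0 (2 * (K $$ (2, 1))\<^sup>2 * ?m)"
  have m: "map (\<lambda>K. drop_second 0 * K * kron (mat2 x y z w) (mat2 x y z w) * (drop_second 0 * K)\<^sup>T) Ks = map ?W Ks"
  proof (rule map_cong[OF refl])
    fix K assume "K \<in> set Ks"
    then obtain a b where K: "K = stage1_kraus a b" using Ks by blast
    show "drop_second 0 * K * kron (mat2 x y z w) (mat2 x y z w) * (drop_second 0 * K)\<^sup>T = ?W K"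
      unfolding K stage1_branch by (simp add: stage1_kraus_eq)
  qed
  have e: "ensemble 4 (map ?W Ks) = proj (vecm (mat2 \<alpha> 0 0 \<beta>))"
    using stage1_out_pure[OF Ks mat2_carrier, of x y z w] out unfolding m vec_of_list_eq_vecm by simp
  have p00: "proj (vecm (mat2 u 0 0 v)) $$ (0, 0) = of_real ((cmod u)\<^sup>2)"
    and p33: "proj (vecm (mat2 u 0 0 v)) $$ (3, 3) = of_real ((cmod v)\<^sup>2)" for u v
    by (simp_all add: proj_index vecm_index complex_norm_square del: of_real_power)
  have "(\<Sum>K\<leftarrow>Ks. complex_of_real ((cmod (2 * (K $$ (0, 1))\<^sup>2 * ?p))\<^sup>2)) = of_real ((cmod \<alpha>)\<^sup>2)"
    using arg_cong[OF e, of "\<lambda>M. M $$ (0, 0)"]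
    by (simp add: ensemble_index comp_def p00 del: of_real_power)
  moreover have "(\<Sum>K\<leftarrow>Ks. complex_of_real ((cmod (2 * (K $$ (2, 1))\<^sup>2 * ?m))\<^sup>2)) = of_real ((cmod \<beta>)\<^sup>2)"
    using arg_cong[OF e, of "\<lambda>M. M $$ (3, 3)"]
    by (simp add: ensemble_index comp_def p33 del: of_real_power)
  moreover have "(\<Sum>K\<leftarrow>Ks. complex_of_real (f K)) = of_real (\<Sum>K\<leftarrow>Ks. f K)" for f
    by (induction Ks) auto
  ultimately have "(\<Sum>K\<leftarrow>Ks. (cmod (2 * (K $$ (0, 1))\<^sup>2 * ?p))\<^sup>2) = (cmod \<alpha>)\<^sup>2"
    "(\<Sum>K\<leftarrow>Ks. (cmod (2 * (K $$ (2, 1))\<^sup>2 * ?m))\<^sup>2) = (cmod \<beta>)\<^sup>2"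
    by (simp_all only: of_real_eq_iff)
  moreover have "(cmod (2 * u\<^sup>2 * v))\<^sup>2 = 4 * cmod u ^ 4 * (cmod v)\<^sup>2" for u v
    by (simp add: norm_mult norm_power power_mult_distrib flip: power_mult)
  ultimately have sums: "4 * (\<Sum>K\<leftarrow>Ks. cmod (K $$ (0, 1)) ^ 4) * (cmod ?p)\<^sup>2 = (cmod \<alpha>)\<^sup>2"
    "4 * (\<Sum>K\<leftarrow>Ks. cmod (K $$ (2, 1)) ^ 4) * (cmod ?m)\<^sup>2 = (cmod \<beta>)\<^sup>2"
    by (simp_all add: sum_list_const_mult sum_list_mult_const)
  have "(cmod \<alpha>)\<^sup>2 \<le> (cmod ?p)\<^sup>2" "(cmod \<beta>)\<^sup>2 \<le> (cmod ?m)\<^sup>2"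
    unfolding sums[symmetric] using stage1_family_coefficients[OF fam]
    by (auto intro!: mult_left_le_one_le mult_nonneg_nonneg sum_list_nonneg)
  then have "cmod \<alpha> \<le> cmod ?p" "cmod \<beta> \<le> cmod ?m"
    by (simp_all add: power2_le_iff_abs_le)
  then show ?thesis unfolding norm_mult by (intro mult_mono) auto
qed

section \<open>The two-copy bound for stage 2\<close>

lemma kron_schmidt:
  "kron (mat2 \<alpha> 0 0 \<beta>) (mat2 \<alpha> 0 0 \<beta>) =
    mat 4 4 (\<lambda>(i, j). if i = j then [\<alpha>\<^sup>2, \<alpha> * \<beta>, \<alpha> * \<beta>, \<beta>\<^sup>2] ! i else 0)"
  by (rule eq_matI) (auto elim!: less_four_cases simp: kron_index power2_eq_square)

text \<open>On \<open>|00\<rangle>|00\<rangle>\<close> and \<open>|11\<rangle>|11\<rangle>\<close> an LOCC branch outputs a product vector, which can be a multiple of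
  \<open>\<phi>\<^sup>+\<close> only if it vanishes. Hence only the \<open>\<alpha>\<beta>\<close> component contributes.\<close>

lemma universal_ECP_bound:
  assumes ecp: "universal_conclusive_ECP 2 schmidt_states E"
  shows "Re (mtrace (E (copies 2 (proj (vec_of_list [\<alpha>, 0, 0, \<beta>]))))) \<le> 2 * (cmod (\<alpha> * \<beta>))\<^sup>2"
proof -
  obtain E' where "locc_instrument 4 4 2 2 E E'"
    using ecp by (auto simp: universal_conclusive_ECP_def)
  then obtain cs where cs: "\<And>A B. (A, B) \<in> set cs \<Longrightarrow> A \<in> carrier_mat 2 4 \<and> B \<in> carrier_mat 2 4"
    and E': "\<And>X. X \<in> carrier_mat 4 4 \<Longrightarrow> E (proj (vecm X)) = ensemble (2 * 2) (act cs [X])"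
    and le: "\<And>X. X \<in> carrier_mat 4 4 \<Longrightarrow> (\<Sum>V\<leftarrow>act cs [X]. fro V) \<le> fro X"
    by (rule locc_instrument_pure) (rule that; blast)
  have E: "E (proj (vecm X)) = ensemble 4 (act cs [X])" if "X \<in> carrier_mat 4 4" for X
    using E'[OF that] by (simp del: act_simps)
  let ?X = "\<lambda>\<alpha> \<beta>. kron (mat2 \<alpha> 0 0 \<beta>) (mat2 \<alpha> 0 0 \<beta>)"
  have Xc: "?X \<alpha> \<beta> \<in> carrier_mat 4 4" for \<alpha> \<beta> by (simp add: kron_schmidt)
  have c: "set (act cs Vs) \<subseteq> carrier_mat 2 2" for Vs
    by (rule act_carrier) (use cs in auto)
  have EX: "E (copies 2 (proj (vec_of_list [\<alpha>, 0, 0, \<beta>]))) = ensemble 4 (act cs [?X \<alpha> \<beta>])" for \<alpha> \<beta>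
    unfolding vec_of_list_eq_vecm copies_2_proj[OF mat2_carrier] by (rule E[OF Xc])
  have entry: "(A * ?X \<alpha> \<beta> * B\<^sup>T) $$ (i, j) = \<alpha>\<^sup>2 * (A $$ (i, 0) * B $$ (j, 0)) +
      \<alpha> * \<beta> * (A $$ (i, 1) * B $$ (j, 1) + A $$ (i, 2) * B $$ (j, 2)) + \<beta>\<^sup>2 * (A $$ (i, 3) * B $$ (j, 3))"
    if "(A, B) \<in> set cs" "i < 2" "j < 2" for A B i j \<alpha> \<beta>
    using cs[OF that(1)] that(2,3)
    by (subst sandwich_index) (auto simp: kron_schmidt sum_lessThan_4 algebra_simps)
  have concl: "(A * ?X \<alpha> \<beta> * B\<^sup>T) $$ (0, 1) = 0 \<and> (A * ?X \<alpha> \<beta> * B\<^sup>T) $$ (1, 0) = 0 \<and>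
      (A * ?X \<alpha> \<beta> * B\<^sup>T) $$ (0, 0) = (A * ?X \<alpha> \<beta> * B\<^sup>T) $$ (1, 1)"
    if "(A, B) \<in> set cs" "(cmod \<alpha>)\<^sup>2 + (cmod \<beta>)\<^sup>2 = 1" for A B \<alpha> \<beta>
  proof -
    have "proj (vec_of_list [\<alpha>, 0, 0, \<beta>]) \<in> schmidt_states"
      using that(2) by (auto simp: schmidt_states_def simp del: vec_of_list_Cons)
    then have "conclusive (ensemble 4 (act cs [?X \<alpha> \<beta>]))"
      using ecp by (simp only: universal_conclusive_ECP_def EX[symmetric])
    moreover have "A * ?X \<alpha> \<beta> * B\<^sup>T \<in> set (act cs [?X \<alpha> \<beta>])"
      using that(1) by force
    ultimately show ?thesis
      using conclusive_ensemble_iff[OF c] by blast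
  qed
  \<comment> \<open>A matrix \<open>u v^T\<close> that is a multiple of the identity vanishes, since
    its rank is at most one.\<close>
  have zero: "u0 * v0 = 0 \<and> u1 * v1 = 0" if "u0 * v1 = 0" "u1 * v0 = 0" "u0 * v0 = u1 * v1"
    for u0 u1 v0 v1 :: complex
    using that by auto
  have "(\<Sum>V\<leftarrow>act cs [?X \<alpha> \<beta>]. fro V) = (\<Sum>V\<leftarrow>act cs [flip_mat 0]. (cmod (\<alpha> * \<beta>))\<^sup>2 * fro V)"
  proof -
    have "fro (A * ?X \<alpha> \<beta> * B\<^sup>T) = (cmod (\<alpha> * \<beta>))\<^sup>2 * fro (A * flip_mat 0 * B\<^sup>T)"
      if AB: "(A, B) \<in> set cs" for A B
    proof -
      have d: "dim_row A = 2" "dim_row B = 2" "dim_col A = 4" "dim_col B = 4" using cs[OF AB] by auto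
      \<comment> \<open>The Schmidt coefficients (1, 0) and (0, 1) isolate the images of |00>|00>
        and |11>|11>.\<close>
      have "A $$ (i, 0) * B $$ (j, 0) = 0 \<and> A $$ (i, 3) * B $$ (j, 3) = 0" if "i < 2" "j < 2" for i j
        using concl[OF AB, of 1 0] concl[OF AB, of 0 1] entry[OF AB] that
          zero[of "A $$ (0, 0)" "B $$ (1, 0)" "A $$ (1, 0)" "B $$ (0, 0)"]
          zero[of "A $$ (0, 3)" "B $$ (1, 3)" "A $$ (1, 3)" "B $$ (0, 3)"]
        by (auto elim!: less_two_cases)
      note outer = this
      \<comment> \<open>What remains of two copies is \<open>\<alpha> * \<beta>\<close> times the
        fixed matrix \<open>flip_mat 0\<close>, to which the norm bound for \<open>cs\<close> is
        applied.\<close>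
      have "(A * ?X \<alpha> \<beta> * B\<^sup>T) $$ (i, j) = \<alpha> * \<beta> * (A * flip_mat 0 * B\<^sup>T) $$ (i, j)"
        if ij: "i < 2" "j < 2" for i j
      proof -
        have "(A * flip_mat 0 * B\<^sup>T) $$ (i, j) = A $$ (i, 1) * B $$ (j, 1) + A $$ (i, 2) * B $$ (j, 2)"
          using ij d by (subst sandwich_index) (auto simp: flip_mat_def sum_lessThan_4)
        then show ?thesis
          using outer[OF ij] unfolding entry[OF AB ij] by (simp only:) simp
      qed
      then show ?thesis
        unfolding fro_def sum_distrib_left
        by (intro sum.cong) (auto simp: d norm_mult power_mult_distrib mult_ac simp del: index_mult_mat(1))
    qed
    then show ?thesis
      by (auto simp: comp_def case_prod_unfold intro!: arg_cong[of _ _ sum_list])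
  qed
  also have "\<dots> \<le> (cmod (\<alpha> * \<beta>))\<^sup>2 * fro (flip_mat 0)"
    unfolding sum_list_const_mult using le[OF flip_mat_carrier] by (intro mult_left_mono) auto
  finally have "(\<Sum>V\<leftarrow>act cs [?X \<alpha> \<beta>]. fro V) \<le> 2 * (cmod (\<alpha> * \<beta>))\<^sup>2"
    by (simp add: fro_flip_mat)
  moreover have "mtrace (ensemble 4 (act cs [?X \<alpha> \<beta>])) = of_real (\<Sum>V\<leftarrow>act cs [?X \<alpha> \<beta>]. fro V)"
    using mtrace_ensemble[OF c] by (simp del: act_simps)
  ultimately show ?thesis unfolding EX by (simp del: act_simps)
qed

section \<open>The protocol of Kalman et al.\<close>

text \<open>Explicit numerals replace index variables, so that all sixteen entries are settled by
  evaluation.\<close>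

lemma eq_mat_4I:
  assumes "dim_row A = 4" "dim_col A = 4" "dim_row B = 4" "dim_col B = 4"
    and "\<forall>i \<in> {0, 1, 2, 3}. \<forall>j \<in> {0, 1, 2, 3}. A $$ (i, j) = B $$ (i, j)"
  shows "A = B"
proof (rule eq_matI)
  fix i j assume "i < dim_row B" "j < dim_col B"
  then have "i < 4" "j < 4" using assms by simp_all
  then have "i \<in> {0, 1, 2, 3}" "j \<in> {0, 1, 2, 3}" by auto
  then show "A $$ (i, j) = B $$ (i, j)" using assms(5) by blast
qed (use assms in auto)

text \<open>A constant of its own, so that matrix computations see only that it is real and has
  square 1/2.\<close>

definition isqrt2 :: complex where "isqrt2 = 1 / complex_of_real (sqrt 2)"

lemma isqrt2_square [simp]: "isqrt2 * isqrt2 = 1 / 2" "isqrt2\<^sup>2 = 1 / 2" "cnj isqrt2 = isqrt2"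
  by (simp_all add: isqrt2_def power_divide flip: of_real_mult of_real_power)

lemma hadamard_kron_eq:
  "kron hadamard (ketbra 2 0 0) = mat 4 4 (\<lambda>(i, j). if odd i \<or> odd j then 0
     else if i = 2 \<and> j = 2 then - isqrt2 else isqrt2)"
  by (rule eq_mat_4I) (simp_all add: kron_index hadamard_def ketbra_def mat_of_rows_list_def isqrt2_def)

lemma pauli_x_eq: "pauli_x = mat 2 2 (\<lambda>(i, j). if i = j then 0 else 1)"
  by (rule eq_matI) (auto simp: pauli_x_def mat_of_rows_list_def numeral_2_eq_2 less_Suc_eq)

lemma kron_pauli_eq:
  "kron (1\<^sub>m 2) pauli_x = mat 4 4 (\<lambda>(i, j). if (i, j) \<in> {(0, 1), (1, 0), (2, 3), (3, 2)} then 1 else 0)"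
  by (rule eq_mat_4I) (simp_all add: kron_index pauli_x_eq)

lemma cnot_eq:
  "cnot = mat 4 4 (\<lambda>(i, j). if (i, j) \<in> {(0, 0), (1, 1), (2, 3), (3, 2)} then 1 else 0)"
  by (rule eq_mat_4I) (simp_all add: cnot_def mat_of_rows_list_def)

text \<open>NOT and CNOT send |01> to |00> and keep |10>, while |00> and |11> end with target 1 and
  are removed by |0><0|. The Hadamard gate turns the two survivors into sum and difference: a member
  of the stage 1 family with a = b = 1 / sqrt 2.\<close>

lemma kalman_K_eq: "kalman_K = stage1_kraus isqrt2 isqrt2"
proof -
  have e: "cnot * kron (1\<^sub>m 2) pauli_x =
      mat 4 4 (\<lambda>(i, j). if (i, j) \<in> {(0, 1), (1, 0), (2, 2), (3, 3)} then 1 else 0)"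
    unfolding cnot_eq kron_pauli_eq
    by (rule eq_mat_4I) (simp_all add: mult_index sum_lessThan_4 del: index_mult_mat(1))
  have "kalman_K = kron hadamard (ketbra 2 0 0) * (cnot * kron (1\<^sub>m 2) pauli_x)"
    unfolding kalman_K_def hadamard_kron_eq cnot_eq kron_pauli_eq by (subst mat_mult_assoc) auto
  also have "\<dots> = stage1_kraus isqrt2 isqrt2"
    unfolding e hadamard_kron_eq stage1_kraus_eq
    by (intro eq_mat_4I) (simp_all add: mult_index sum_lessThan_4 del: index_mult_mat(1))
  finally show ?thesis .
qed

lemma kalman_K_carrier [simp]: "kalman_K \<in> carrier_mat 4 4"
  by (simp add: kalman_K_eq)

lemma kalman_out_eq: "kalman_out = stage1_out [kalman_K]"
proof
  fix \<rho>
  have "kron kalman_K kalman_K \<in> carrier_mat 16 16"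
    using kron_carrier[OF kalman_K_carrier kalman_K_carrier] by simp
  then have "kron kalman_K kalman_K * \<rho> * mat_adjoint (kron kalman_K kalman_K) \<in> carrier_mat 16 16"
    by (intro carrier_matI) auto
  then show "kalman_out \<rho> = stage1_out [kalman_K] \<rho>"
    by (simp add: kalman_out_def kalman_map_def stage1_out_def local_map_def sym_ops_def)
qed

lemma kalman_out_pure:
  "kalman_out (copies 2 (proj (vec_of_list [x, y, z, w]))) =
    proj (vec_of_list [x * w + y * z, 0, 0, x * w - y * z])"
proof -
  have "kalman_out (copies 2 (proj (vec_of_list [x, y, z, w]))) = ensemble 4 [mat2 (x * w + y * z) 0 0 (x * w - y * z)]"
    unfolding vec_of_list_eq_vecm kalman_out_eq
    by (subst stage1_out_pure) (auto simp: kalman_K_eq stage1_branch)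
  then show ?thesis
    using ensemble_single[OF mat2_carrier, of "x * w + y * z" 0 0 "x * w - y * z"]
    by (simp only: vec_of_list_eq_vecm) simp
qed

text \<open>On Schmidt form inputs the two eigenvalues coincide, so the operation that prepares
  Schmidt form in stage 1 yields a multiple of the Bell state in stage 2.\<close>

lemma kalman_out_schmidt:
  "kalman_out (copies 2 (proj (vec_of_list [\<alpha>, 0, 0, \<beta>]))) = proj (vec_of_list [\<alpha> * \<beta>, 0, 0, \<alpha> * \<beta>])"
  unfolding kalman_out_pure by simp

lemma conclusive_kalman_out: "conclusive (kalman_out (copies 2 (proj (vec_of_list [\<alpha>, 0, 0, \<beta>]))))"
  unfolding kalman_out_schmidt unfolding vec_of_list_eq_vecm
  using conclusive_ensemble_iff[of "[mat2 (\<alpha> * \<beta>) 0 0 (\<alpha> * \<beta>)]"]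
    ensemble_single[OF mat2_carrier, of "\<alpha> * \<beta>" 0 0 "\<alpha> * \<beta>"]
  by simp

lemma mtrace_kalman_out:
  "Re (mtrace (kalman_out (copies 2 (proj (vec_of_list [\<alpha>, 0, 0, \<beta>]))))) = 2 * (cmod (\<alpha> * \<beta>))\<^sup>2"
  unfolding kalman_out_schmidt mtrace_proj_vec_of_list by simp

text \<open>The Gram matrix of \<open>kalman_K\<close> is the projection onto the span of |01> and
  |10>; the failed outcome is the complementary projection.\<close>

lemma measurement_kalman:
  "measurement 4 [kalman_K, mat 4 4 (\<lambda>(i, j). if i = j \<and> (i = 0 \<or> i = 3) then 1 else 0)]"
  unfolding measurement_def kalman_K_eq stage1_kraus_eq
  by (intro conjI eq_mat_4I) (simp_all add: mult_index sum_lessThan_4 del: index_mult_mat(1))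

text \<open>Discarding a qubit amounts to measuring it in the computational basis and forgetting the
  outcome.\<close>

lemma measurement_drop: "measurement 4 [drop_second 0, drop_second 1]"
  unfolding measurement_def drop_second_def
  by (intro conjI eq_mat_4I) (simp_all add: mult_index lessThan_nat_numeral del: index_mult_mat(1))

lemma submeasurement_kalman: "submeasurement 4 4 [kalman_K]"
  unfolding submeasurement_def
  by (rule exI, rule conjI[OF measurement_kalman]) (simp add: kalman_K_eq stage1_kraus_eq)

lemma submeasurement_drop: "submeasurement 4 2 [drop_second 0, drop_second 1]"
  unfolding submeasurement_def
  by (rule exI, rule conjI[OF measurement_drop]) simp

lemma sym_ops_single: "sym_ops [K] = combine Pair [K] [K]"
  by (simp add: sym_ops_def)

lemma product_locc_kalman_step: "product_locc 4 4 4 4 (local_map 16 (sym_ops [kalman_K]))"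
  using product_loccI[OF submeasurement_kalman submeasurement_kalman] by (simp add: sym_ops_single)

lemma product_locc_kalman_out: "product_locc 4 4 2 2 kalman_out"
proof -
  have "product_locc 4 4 2 2 (\<lambda>\<rho>. local_map 4 discard_ops (local_map 16 (sym_ops [kalman_K]) \<rho>))"
    using product_loccI[OF submeasurement_drop submeasurement_drop]
    by (intro product_locc_compose[OF product_locc_kalman_step]) (simp add: discard_ops_combine)
  then show ?thesis by (simp add: kalman_out_eq stage1_out_def[abs_def] discard_def)
qed

lemma product_locc_kalman_concat: "product_locc 16 16 2 2 (concat_map [kalman_K] kalman_out)"
proof -
  have 1: "product_locc 16 16 16 16 (local_map 256 (Defs.parallel (sym_ops [kalman_K])))"
    using product_locc_parallel[OF submeasurement_kalman submeasurement_kalman]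
    by (simp add: sym_ops_single del: combine_simps)
  have 2: "product_locc 16 16 4 4 (local_map 16 (Defs.parallel discard_ops))"
    using product_locc_parallel[OF submeasurement_drop submeasurement_drop]
    by (simp add: discard_ops_combine del: combine_simps)
  have "product_locc 16 16 2 2 (\<lambda>\<rho>. kalman_out
      (local_map 16 (Defs.parallel discard_ops) (local_map 256 (Defs.parallel (sym_ops [kalman_K])) \<rho>)))"
    by (rule product_locc_compose[OF product_locc_compose[OF 1 2] product_locc_kalman_out])
  then show ?thesis by (simp add: concat_map_def[abs_def])
qed

lemma concat_map_kalman:
  "concat_map [kalman_K] E (copies 4 (proj (vec_of_list [x, y, z, w]))) =
    E (copies 2 (proj (vec_of_list [x * w + y * z, 0, 0, x * w - y * z])))"
  using concat_map_pure[of "[kalman_K]" "mat2 x y z w"] kalman_out_pure[of x y z w]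
  by (simp only: vec_of_list_eq_vecm kalman_out_eq) simp

lemma carrier_vec_4:
  assumes "v \<in> carrier_vec 4"
  shows "v = vec_of_list [v $ 0, v $ 1, v $ 2, v $ 3]"
  by (rule eq_vecI) (use assms in \<open>auto simp: vec_of_list_index less_Suc_eq numeral_2_eq_2 numeral_3_eq_3
      simp del: vec_of_list_Cons\<close>)

lemma pure_statesE:
  assumes "\<rho> \<in> pure_states"
  obtains x y z w where "\<rho> = proj (vec_of_list [x, y, z, w])"
proof -
  obtain v where "v \<in> carrier_vec 4" "\<rho> = proj v" using assms by (auto simp: pure_states_def)
  then show thesis using that[of "v $ 0" "v $ 1" "v $ 2" "v $ 3"] carrier_vec_4 by metis
qed

lemma pure_statesI:
  assumes "(cmod x)\<^sup>2 + (cmod y)\<^sup>2 + (cmod z)\<^sup>2 + (cmod w)\<^sup>2 = 1"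
  shows "proj (vec_of_list [x, y, z, w]) \<in> pure_states"
proof -
  define v where "v = vec_of_list [x, y, z, w]"
  have v: "v $ 0 = x" "v $ 1 = y" "v $ 2 = z" "v $ 3 = w" "dim_vec v = 4"
    by (simp_all add: v_def vec_of_list_index numeral_2_eq_2 numeral_3_eq_3 del: vec_of_list_Cons)
  have "v \<bullet>c v = x * cnj x + y * cnj y + z * cnj z + w * cnj w"
    using v by (simp add: scalar_prod_def atLeast0LessThan sum_lessThan_4)
  also have "\<dots> = of_real ((cmod x)\<^sup>2 + (cmod y)\<^sup>2 + (cmod z)\<^sup>2 + (cmod w)\<^sup>2)"
    by (simp add: complex_norm_square del: of_real_power)
  finally have "v \<bullet>c v = 1" using assms by simp
  moreover have "v \<in> carrier_vec 4" using v(5) by (rule carrier_vecI)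
  ultimately show ?thesis unfolding pure_states_def v_def by blast
qed

lemma universal_ECP_kalman: "universal_conclusive_ECP 2 schmidt_states kalman_out"
  unfolding universal_conclusive_ECP_def
  using product_locc_instrument[OF product_locc_kalman_out] conclusive_kalman_out
  by (auto simp: schmidt_states_def simp del: vec_of_list_Cons)

lemma concatenated_ECP_kalman: "concatenated_ECP [kalman_K] kalman_out"
  unfolding concatenated_ECP_def
proof (intro conjI ballI impI)
  \<comment> \<open>Both coefficients have modulus 1 / sqrt 2, so
    \<open>2 * (cmod a ^ 4 + cmod b ^ 4) \<le> 1\<close> holds with equality.\<close>
  have c: "cmod isqrt2 ^ 4 = 1 / 4"
  proof -
    have "(cmod isqrt2)\<^sup>2 = 1 / 2"
      using arg_cong[OF isqrt2_square(2), of cmod] by (simp add: norm_power del: isqrt2_square)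
    moreover have "cmod isqrt2 ^ 4 = ((cmod isqrt2)\<^sup>2)\<^sup>2" by (simp flip: power_mult)
    ultimately show ?thesis by (simp only:) (simp add: power_divide)
  qed
  have "isqrt2 \<noteq> 0" by (simp add: isqrt2_def)
  then have "\<exists>a b. a \<noteq> 0 \<and> b \<noteq> 0 \<and> 2 * (cmod a ^ 4 + cmod b ^ 4) \<le> 1 \<and> kalman_K = stage1_kraus a b"
    using kalman_K_eq c by (intro exI[of _ isqrt2]) auto
  moreover have "\<exists>\<alpha> \<beta>. stage1_out [kalman_K] (copies 2 \<rho>) = proj (vec_of_list [\<alpha>, 0, 0, \<beta>])"
    if "\<rho> \<in> pure_states" for \<rho>
    using that by (elim pure_statesE) (metis kalman_out_eq kalman_out_pure)
  ultimately show "stage1_family [kalman_K]"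
    unfolding stage1_family_def using product_locc_instrument[OF product_locc_kalman_step] by simp
  show "universal_conclusive_ECP 2 schmidt_states kalman_out"
    by (rule universal_ECP_kalman)
  have "conclusive (concat_map [kalman_K] kalman_out (copies 4 \<rho>))" if "\<rho> \<in> pure_states" for \<rho>
    using that by (elim pure_statesE) (simp only: concat_map_kalman conclusive_kalman_out)
  then show "universal_conclusive_ECP 4 pure_states (concat_map [kalman_K] kalman_out)"
    unfolding universal_conclusive_ECP_def
    using product_locc_instrument[OF product_locc_kalman_concat] by simp
  fix v :: "complex vec" assume v: "v \<in> carrier_vec 4" "product_vec v"
  \<comment> \<open>The coefficient matrix of a product vector is singular. Its determinant is the
    second stage 1 coefficient, and the stage 2 probability carries its squared modulus as a
    factor.\<close>
  then have "v $ 0 * v $ 3 - v $ 1 * v $ 2 = 0"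
    by (auto simp: product_vec_def)
  then show "success_prob 4 (concat_map [kalman_K] kalman_out) (proj v) = 0"
    by (subst carrier_vec_4[OF v(1)])
      (simp add: success_prob_def concat_map_kalman mtrace_kalman_out del: vec_of_list_Cons)
qed

section \<open>Success probabilities of the two stages\<close>

lemma two_stage_prob_schmidt:
  assumes "S (copies 2 \<rho>) = proj (vec_of_list [\<alpha>, 0, 0, \<beta>])"
  defines "s \<equiv> (cmod \<alpha>)\<^sup>2 + (cmod \<beta>)\<^sup>2"
  shows "two_stage_prob S E \<rho> = s\<^sup>2 * Re (mtrace (E (copies 2
    (proj (vec_of_list [\<alpha> / of_real (sqrt s), 0, 0, \<beta> / of_real (sqrt s)])))))"
  unfolding two_stage_prob_def success_prob_def assms renorm_schmidt mtrace_proj_vec_of_list by simp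

text \<open>Each amplitude is divided by the root of \<open>s\<close>, so the stage 2 value picks up
  a factor 1 / s^2, which the squared stage 1 probability cancels. For \<open>s = 0\<close> both
  sides vanish.\<close>

lemma schmidt_weight:
  fixes \<alpha> \<beta> :: complex
  defines "s \<equiv> (cmod \<alpha>)\<^sup>2 + (cmod \<beta>)\<^sup>2"
  shows "s\<^sup>2 * (2 * (cmod (\<alpha> / of_real (sqrt s) * (\<beta> / of_real (sqrt s))))\<^sup>2) = 2 * (cmod (\<alpha> * \<beta>))\<^sup>2"
proof (cases "s = 0")
  case True
  then have "\<alpha> = 0" by (simp add: s_def add_nonneg_eq_0_iff)
  then show ?thesis using True by simp
next
  case False
  have "s \<ge> 0" by (simp add: s_def)
  then have "complex_of_real (sqrt s) * of_real (sqrt s) = of_real s"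
    by (simp flip: of_real_mult)
  then have "\<alpha> / of_real (sqrt s) * (\<beta> / of_real (sqrt s)) = \<alpha> * \<beta> / of_real s"
    by (simp only: times_divide_times_eq)
  then show ?thesis using False by (simp only:) (simp add: norm_divide power_divide)
qed

text \<open>With \<open>u\<close> and \<open>w\<close> the squares of c1 c4 and c2 c3, one side is 2
  |u - w|^2 and the other its expansion; the real part is the cross term.\<close>

lemma success_formula:
  fixes c1 c2 c3 c4 :: complex
  shows "2 * cmod (c2 ^ 4 * c3 ^ 4) + 2 * cmod (c1 ^ 4 * c4 ^ 4)
      - 4 * Re (c1\<^sup>2 * c4\<^sup>2 * (cnj c2)\<^sup>2 * (cnj c3)\<^sup>2) =
    2 * (cmod ((c1 * c4 + c2 * c3) * (c1 * c4 - c2 * c3)))\<^sup>2"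
proof -
  define u w where "u = (c1 * c4)\<^sup>2" and "w = (c2 * c3)\<^sup>2"
  have "(c1 * c4 + c2 * c3) * (c1 * c4 - c2 * c3) = u - w"
    by (simp add: u_def w_def power2_eq_square algebra_simps)
  moreover have "c2 ^ 4 * c3 ^ 4 = w\<^sup>2" "c1 ^ 4 * c4 ^ 4 = u\<^sup>2"
    by (simp_all add: u_def w_def power_mult_distrib flip: power_mult)
  moreover have "c1\<^sup>2 * c4\<^sup>2 * (cnj c2)\<^sup>2 * (cnj c3)\<^sup>2 = u * cnj w"
    by (simp add: u_def w_def power_mult_distrib)
  moreover have "(cmod (u - w))\<^sup>2 = (cmod u)\<^sup>2 + (cmod w)\<^sup>2 - 2 * Re (u * cnj w)"
    unfolding cmod_power2 by (simp add: power2_eq_square algebra_simps)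
  ultimately show ?thesis by (simp add: norm_power)
qed

theorem mainTheorem5:
  fixes c1 c2 c3 c4 \<alpha> \<beta> :: complex
  assumes "(cmod c1)\<^sup>2 + (cmod c2)\<^sup>2 + (cmod c3)\<^sup>2 + (cmod c4)\<^sup>2 = 1"
    and "(cmod \<alpha>)\<^sup>2 + (cmod \<beta>)\<^sup>2 = 1"
  shows
    "let \<psi> = proj (vec_of_list [c1, c2, c3, c4]);
         \<psi>\<^sub>S = proj (vec_of_list [\<alpha>, 0, 0, \<beta>]);
         p = 2 * cmod (c2 ^ 4 * c3 ^ 4) + 2 * cmod (c1 ^ 4 * c4 ^ 4)
               - 4 * Re (c1\<^sup>2 * c4\<^sup>2 * (cnj c2)\<^sup>2 * (cnj c3)\<^sup>2)
     in
       conclusive (kalman_out (copies 2 (renorm (kalman_out (copies 2 \<psi>))))) \<and>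
       two_stage_prob kalman_out kalman_out \<psi> = p \<and>
       concatenated_ECP [kalman_K] kalman_out \<and>
       success_prob 4 (concat_map [kalman_K] kalman_out) \<psi> = p \<and>
       (\<forall>Ks E. concatenated_ECP Ks E \<longrightarrow>
          two_stage_prob (stage1_out Ks) E \<psi> \<le> p \<and>
          success_prob 4 (concat_map Ks E) \<psi> \<le> p) \<and>
       universal_conclusive_ECP 2 schmidt_states kalman_out \<and>
       success_prob 2 kalman_out \<psi>\<^sub>S = 2 * (cmod (\<alpha> * \<beta>))\<^sup>2 \<and>
       (\<forall>E. universal_conclusive_ECP 2 schmidt_states E \<longrightarrow>
          success_prob 2 E \<psi>\<^sub>S \<le> 2 * (cmod (\<alpha> * \<beta>))\<^sup>2)"
proof -
  let ?\<psi> = "proj (vec_of_list [c1, c2, c3, c4])"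
  let ?p = "c1 * c4 + c2 * c3" and ?m = "c1 * c4 - c2 * c3"
  have optimal: "two_stage_prob (stage1_out Ks) E ?\<psi> \<le> 2 * (cmod (?p * ?m))\<^sup>2 \<and>
      success_prob 4 (concat_map Ks E) ?\<psi> \<le> 2 * (cmod (?p * ?m))\<^sup>2"
    if ecp: "concatenated_ECP Ks E" for Ks E
  proof -
    have fam: "stage1_family Ks" and E: "universal_conclusive_ECP 2 schmidt_states E"
      using ecp by (simp_all add: concatenated_ECP_def)
    obtain \<gamma> \<delta> where out: "stage1_out Ks (copies 2 ?\<psi>) = proj (vec_of_list [\<gamma>, 0, 0, \<delta>])"
      using fam pure_statesI[OF assms(1)] unfolding stage1_family_def by blast
    have "cmod (\<gamma> * \<delta>) \<le> cmod (?p * ?m)"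
      using stage1_output_bound[OF fam] out unfolding vec_of_list_eq_vecm[of c1] by blast
    then have le: "2 * (cmod (\<gamma> * \<delta>))\<^sup>2 \<le> 2 * (cmod (?p * ?m))\<^sup>2"
      by (simp add: power_mono del: norm_mult)
    \<comment> \<open>The stage 2 bound is applied to the renormalized output, and
      \<open>schmidt_weight\<close> removes the normalization again.\<close>
    have "two_stage_prob (stage1_out Ks) E ?\<psi> \<le> 2 * (cmod (\<gamma> * \<delta>))\<^sup>2"
      unfolding two_stage_prob_schmidt[of "stage1_out Ks", OF out]
      by (rule order_trans[OF mult_left_mono[OF universal_ECP_bound[OF E] zero_le_power2]])
        (simp only: schmidt_weight order_refl)
    moreover have Ks: "set Ks \<subseteq> carrier_mat 4 4"
      using fam unfolding stage1_family_def by (metis stage1_kraus_carrier subsetI)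
    \<comment> \<open>Here the unnormalized stage 1 output enters the same bound, which holds for
      arbitrary \<gamma> and \<delta>.\<close>
    have "success_prob 4 (concat_map Ks E) ?\<psi> \<le> 2 * (cmod (\<gamma> * \<delta>))\<^sup>2"
      using universal_ECP_bound[OF E, of \<gamma> \<delta>] out
      unfolding success_prob_def vec_of_list_eq_vecm[of c1] concat_map_pure[OF Ks mat2_carrier] by simp
    ultimately show ?thesis using le by linarith
  qed
  have "conclusive (kalman_out (copies 2 (renorm (kalman_out (copies 2 ?\<psi>)))))"
    unfolding kalman_out_pure[of c1] renorm_schmidt by (rule conclusive_kalman_out)
  moreover have "two_stage_prob kalman_out kalman_out ?\<psi> = 2 * (cmod (?p * ?m))\<^sup>2"
    unfolding two_stage_prob_schmidt[of kalman_out, OF kalman_out_pure] mtrace_kalman_out schmidt_weight ..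
  moreover have "success_prob 4 (concat_map [kalman_K] kalman_out) ?\<psi> = 2 * (cmod (?p * ?m))\<^sup>2"
    unfolding success_prob_def concat_map_kalman mtrace_kalman_out ..
  ultimately show ?thesis
    unfolding Let_def success_formula success_prob_def[of 2]
    using optimal concatenated_ECP_kalman universal_ECP_kalman mtrace_kalman_out universal_ECP_bound
    by blast
qed

end
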